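(* Let $I\subset S=k[x_1,\ldots,x_n]$ be a canonical critical squarefree monomial ideal. Then $I$ is componentwise linear.
   Context: $k$ is a field, $S=k[x_1,\ldots,x_n]$. For a monomial ideal $J$, $G(J)$ denotes its minimal system of monomial generators, and $\mathrm{supp}(m)$ is the set of variables dividing the monomial $m$. A squarefree monomial ideal $I\subset S$ is called critical if it is obtained by the following recursive procedure: (a) $I$ is of the form $I=(x_i,m)$ for some variable $x_i$ and some squarefree monomial $m$ with $x_i\nmid m$; or (b) there are a variable $x_j$, a squarefree monomial $m'$ and a critical ideal $J$, with $x_j\nmid mm'$ and $\mathrm{supp}(m)\cap\mathrm{supp}(m')=\emptyset$ for all $m\in G(J)$, such that $I=(x_j)+m'J$. A squarefree monomial ideal $I\subset S$ is called canonical critical if there is a monomial $w\in S$ such that $I=wJ$, where $J$ is a critical squarefree monomial ideal. A graded ideal $I$ is componentwise linear if for all $j$ the ideal $I_{\langle j\rangle}$ generated by all homogeneous elements of degree $j$ in $I$ has a linear resolution. *)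

theory Defs
  imports
    "HOL-Library.Poly_Mapping"
    "HOL-Library.Set_Algebras"
    "Jordan_Normal_Form.Matrix_Kernel"
begin

text \<open>
  The polynomial ring \<open>S = k[x\<^sub>1,\<dots>,x\<^sub>n]\<close> is the type \<open>('n, 'k) mpoly\<close> with \<open>'k :: field\<close> and
  \<open>'n :: finite\<close>, where \<open>n = CARD('n)\<close>: a polynomial is a finitely supported function from
  exponent vectors to coefficients.
\<close>

type_synonym ('n, 'k) mpoly = "('n \<Rightarrow>\<^sub>0 nat) \<Rightarrow>\<^sub>0 'k"

text \<open>Ideals of a commutative ring are its submodules as a module over itself.\<close>

global_interpretation idl: Modules.module "(*) :: 'a::comm_ring_1 \<Rightarrow> 'a \<Rightarrow> 'a"
  defines is_ideal = idl.subspace and ideal_of = idl.span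
  by unfold_locales (simp_all add: algebra_simps)

text \<open>Reassociates products against \<open>mult.assoc\<close>, so it must not stay a simp rule.\<close>

declare idl.scale_scale [simp del]


subsection \<open>Monomials and monomial ideals\<close>

definition mono_of :: "('n \<Rightarrow>\<^sub>0 nat) \<Rightarrow> ('n, 'k::field) mpoly"
  where "mono_of t = Poly_Mapping.single t 1"

definition Var :: "'n \<Rightarrow> ('n, 'k::field) mpoly"
  where "Var i = mono_of (Poly_Mapping.single i 1)"

definition monomial :: "('n, 'k::field) mpoly \<Rightarrow> bool"
  where "monomial m \<longleftrightarrow> m \<in> range mono_of"

definition squarefree_monomial :: "('n, 'k::field) mpoly \<Rightarrow> bool"
  where "squarefree_monomial m \<longleftrightarrow> (\<exists>t. m = mono_of t \<and> (\<forall>i. Poly_Mapping.lookup t i \<le> 1))"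

definition supp :: "('n, 'k::field) mpoly \<Rightarrow> 'n set"
  where "supp m = {i. Var i dvd m}"

definition monomial_ideal :: "('n, 'k::field) mpoly set \<Rightarrow> bool"
  where "monomial_ideal I \<longleftrightarrow> (\<exists>A. (\<forall>m\<in>A. monomial m) \<and> I = ideal_of A)"

definition squarefree_monomial_ideal :: "('n, 'k::field) mpoly set \<Rightarrow> bool"
  where "squarefree_monomial_ideal I \<longleftrightarrow>
    (\<exists>A. (\<forall>m\<in>A. squarefree_monomial m) \<and> I = ideal_of A)"

definition is_min_mono_gens :: "('n, 'k::field) mpoly set \<Rightarrow> ('n, 'k) mpoly set \<Rightarrow> bool"
  where "is_min_mono_gens B J \<longleftrightarrow>
    (\<forall>m\<in>B. monomial m) \<and> ideal_of B = J \<and> (\<forall>C. C \<subset> B \<longrightarrow> ideal_of C \<noteq> J)"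

text \<open>The set \<open>G(J)\<close>; it is well defined for monomial ideals by \<open>is_min_mono_gens_iff\<close> below.\<close>

definition min_mono_gens :: "('n, 'k::field) mpoly set \<Rightarrow> ('n, 'k) mpoly set"
  where "min_mono_gens J = (THE B. is_min_mono_gens B J)"


subsection \<open>Critical and canonical critical ideals\<close>

text \<open>
  Every ideal produced by the procedure is a squarefree monomial ideal, see
  \<open>critical_squarefree_monomial_ideal\<close> below. The monomial \<open>1\<close> counts as squarefree.
\<close>

inductive critical :: "('n, 'k::field) mpoly set \<Rightarrow> bool" where
  base: "squarefree_monomial m \<Longrightarrow> \<not> Var i dvd m \<Longrightarrow> critical (ideal_of {Var i, m})"
| step: "critical J \<Longrightarrow> squarefree_monomial m' \<Longrightarrow>
    (\<forall>m\<in>min_mono_gens J. \<not> Var j dvd m * m' \<and> supp m \<inter> supp m' = {}) \<Longrightarrow>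
    critical (ideal_of {Var j} + m' *o J)"

definition canonical_critical :: "('n, 'k::field) mpoly set \<Rightarrow> bool"
  where "canonical_critical I \<longleftrightarrow>
    squarefree_monomial_ideal I \<and> (\<exists>w J. monomial w \<and> critical J \<and> I = w *o J)"


subsection \<open>Graded free resolutions and componentwise linearity\<close>

definition mdeg :: "('n::finite \<Rightarrow>\<^sub>0 nat) \<Rightarrow> nat"
  where "mdeg t = (\<Sum>i\<in>UNIV. Poly_Mapping.lookup t i)"

definition homogeneous :: "int \<Rightarrow> ('n::finite, 'k::field) mpoly \<Rightarrow> bool"
  where "homogeneous d f \<longleftrightarrow> (\<forall>t\<in>Poly_Mapping.keys f. int (mdeg t) = d)"

definition graded_ideal :: "('n::finite, 'k::field) mpoly set \<Rightarrow> bool"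
  where "graded_ideal I \<longleftrightarrow> (\<exists>A. (\<forall>f\<in>A. \<exists>d. homogeneous d f) \<and> I = ideal_of A)"

text \<open>
  A graded free resolution
  \<open>\<dots> \<rightarrow> F\<^sub>2 \<rightarrow> F\<^sub>1 \<rightarrow> F\<^sub>0 \<rightarrow> I \<rightarrow> 0\<close> of an ideal \<open>I\<close> with finitely generated
  \<open>F\<^sub>i = S(-a\<^sub>i\<^sub>0) \<oplus> S(-a\<^sub>i\<^sub>1) \<oplus> \<dots>\<close> (\<open>r i\<close> summands). The augmentation is \<open>v \<mapsto> g \<bullet> v\<close>, and
  \<open>\<phi> i\<close> is the matrix of the degree \<open>0\<close> map from \<open>F\<^sub>i\<^sub>+\<^sub>1\<close> to \<open>F\<^sub>i\<close>.
\<close>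

definition graded_free_resolution ::
    "('n::finite, 'k::field) mpoly set \<Rightarrow> (nat \<Rightarrow> nat) \<Rightarrow> (nat \<Rightarrow> nat \<Rightarrow> int) \<Rightarrow>
     ('n, 'k) mpoly vec \<Rightarrow> (nat \<Rightarrow> ('n, 'k) mpoly mat) \<Rightarrow> bool"
  where "graded_free_resolution I r a g \<phi> \<longleftrightarrow>
    g \<in> carrier_vec (r 0) \<and>
    (\<forall>i. \<phi> i \<in> carrier_mat (r i) (r (Suc i))) \<and>
    (\<forall>p<r 0. homogeneous (a 0 p) (g $ p)) \<and>
    (\<forall>i. \<forall>p<r i. \<forall>q<r (Suc i). homogeneous (a (Suc i) q - a i p) (\<phi> i $$ (p, q))) \<and>
    (\<lambda>v. g \<bullet> v) ` carrier_vec (r 0) = I \<and>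
    {v \<in> carrier_vec (r 0). g \<bullet> v = 0} = (\<lambda>w. \<phi> 0 *\<^sub>v w) ` carrier_vec (r 1) \<and>
    (\<forall>i. mat_kernel (\<phi> i) = (\<lambda>w. \<phi> (Suc i) *\<^sub>v w) ` carrier_vec (r (Suc (Suc i))))"

text \<open>Minimality: \<open>\<phi> i\<close> maps \<open>F\<^sub>i\<^sub>+\<^sub>1\<close> into \<open>(x\<^sub>1,\<dots>,x\<^sub>n) F\<^sub>i\<close>.\<close>

definition minimal_graded_free_resolution ::
    "('n::finite, 'k::field) mpoly set \<Rightarrow> (nat \<Rightarrow> nat) \<Rightarrow> (nat \<Rightarrow> nat \<Rightarrow> int) \<Rightarrow>
     ('n, 'k) mpoly vec \<Rightarrow> (nat \<Rightarrow> ('n, 'k) mpoly mat) \<Rightarrow> bool"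
  where "minimal_graded_free_resolution I r a g \<phi> \<longleftrightarrow>
    graded_free_resolution I r a g \<phi> \<and>
    (\<forall>i. \<forall>p<r i. \<forall>q<r (Suc i). \<phi> i $$ (p, q) \<in> ideal_of (range Var))"

text \<open>
  The minimal graded free resolution has \<open>F\<^sub>i = S(-d-i)\<^bsup>r i\<^esup>\<close> for all \<open>i\<close>. The zero ideal
  (\<open>r = 0\<close>) has a linear resolution.
\<close>

definition has_linear_resolution :: "('n::finite, 'k::field) mpoly set \<Rightarrow> bool"
  where "has_linear_resolution I \<longleftrightarrow>
    (\<exists>d r a g \<phi>. minimal_graded_free_resolution I r a g \<phi> \<and>
       (\<forall>i. \<forall>p<r i. a i p = d + int i))"

definition degree_component_ideal ::
    "('n::finite, 'k::field) mpoly set \<Rightarrow> nat \<Rightarrow> ('n, 'k) mpoly set"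
  where "degree_component_ideal I j = ideal_of {f \<in> I. homogeneous (int j) f}"

definition componentwise_linear :: "('n::finite, 'k::field) mpoly set \<Rightarrow> bool"
  where "componentwise_linear I \<longleftrightarrow>
    graded_ideal I \<and> (\<forall>j. has_linear_resolution (degree_component_ideal I j))"


subsection \<open>Well-definedness\<close>

lemma mono_of_mult: "mono_of s * mono_of t = mono_of (s + t)"
  by (simp add: mono_of_def mult_single)

lemma keys_mono_of [simp]: "Poly_Mapping.keys (mono_of t :: ('n, 'k::field) mpoly) = {t}"
  by (simp add: mono_of_def)

lemma mono_of_inj [simp]: "(mono_of s :: ('n, 'k::field) mpoly) = mono_of t \<longleftrightarrow> s = t"
  by (metis keys_mono_of singleton_inject)

lemma keys_ideal_of_monomials:
  fixes A :: "('n, 'k::field) mpoly set"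
  assumes "f \<in> ideal_of A" "\<forall>m\<in>A. monomial m" "t \<in> Poly_Mapping.keys f"
  shows "\<exists>s u. mono_of s \<in> A \<and> t = s + u"
  using assms(1,3)
proof (induction arbitrary: t rule: idl.span_induct_alt)
  case base
  then show ?case by simp
next
  case (step c x y)
  show ?case
  proof (cases "t \<in> Poly_Mapping.keys y")
    case True
    then show ?thesis using step by blast
  next
    case False
    then have "t \<in> Poly_Mapping.keys (c * x)"
      using step.prems Poly_Mapping.keys_add[of "c * x" y] by blast
    moreover obtain s where s: "x = mono_of s"
      using step.hyps assms(2) by (auto simp: monomial_def)
    ultimately obtain u where "t = u + s"
      using Poly_Mapping.keys_mult[of c x] by auto
    then show ?thesis using s step.hyps by (metis add.commute)
  qed
qed

lemma mono_of_dvd_iff: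
  "(mono_of s :: ('n, 'k::field) mpoly) dvd mono_of t \<longleftrightarrow> (\<exists>u. t = s + u)"
proof
  assume "(mono_of s :: ('n, 'k) mpoly) dvd mono_of t"
  then obtain c where "(mono_of t :: ('n, 'k) mpoly) = mono_of s * c" by (elim dvdE)
  then have "t \<in> Poly_Mapping.keys ((mono_of s :: ('n, 'k) mpoly) * c)"
    by (metis keys_mono_of insertI1)
  then show "\<exists>u. t = s + u"
    using Poly_Mapping.keys_mult[of "mono_of s" c] by auto
qed (auto simp: mono_of_mult[symmetric])

lemma Var_dvd_mono_of_iff:
  "(Var i :: ('n, 'k::field) mpoly) dvd mono_of t \<longleftrightarrow> 0 < Poly_Mapping.lookup t i"
proof
  assume "0 < Poly_Mapping.lookup t i"
  then have "t = Poly_Mapping.single i 1 + (t - Poly_Mapping.single i 1)"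
    by (intro poly_mapping_eqI) (auto simp: lookup_add lookup_minus lookup_single when_def)
  then show "(Var i :: ('n, 'k) mpoly) dvd mono_of t"
    unfolding Var_def mono_of_dvd_iff by blast
qed (auto simp: Var_def mono_of_dvd_iff lookup_add)

text \<open>The monomials of \<open>J\<close> that are minimal with respect to divisibility generate \<open>J\<close>.\<close>

lemma min_mono_gens_aux:
  fixes J :: "('n::finite, 'k::field) mpoly set"
  assumes "monomial_ideal J"
  defines "M \<equiv> {m \<in> J. monomial m \<and> (\<forall>m'\<in>J. monomial m' \<and> m' dvd m \<longrightarrow> m' = m)}"
  shows "ideal_of M = J"
    and "\<And>B. \<forall>m\<in>B. monomial m \<Longrightarrow> ideal_of B = J \<Longrightarrow> M \<subseteq> B"
proof -
  obtain A where A: "\<forall>m\<in>A. monomial m" "J = ideal_of A"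
    using assms(1) by (auto simp: monomial_ideal_def)
  have "mono_of t \<in> ideal_of M" if "mono_of t \<in> J" for t
    using that
  proof (induction "mdeg t" arbitrary: t rule: less_induct)
    case less
    show ?case
    proof (cases "mono_of t \<in> M")
      case True
      then show ?thesis by (rule idl.span_base)
    next
      case False
      then obtain s where s: "mono_of s \<in> J" "(mono_of s :: ('n, 'k) mpoly) dvd mono_of t" "s \<noteq> t"
        using less.prems by (auto simp: M_def monomial_def)
      then obtain u where u: "t = s + u" by (auto simp: mono_of_dvd_iff)
      with s have "u \<noteq> 0" by auto
      then obtain i where "Poly_Mapping.lookup u i \<noteq> 0" by (metis lookup_zero poly_mapping_eqI)
      then have "mdeg u > 0" by (simp add: mdeg_def sum_nonneg_eq_0_iff flip: neq0_conv) blast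
      then have "mdeg s < mdeg t" by (simp add: u mdeg_def lookup_add sum.distrib)
      with less.hyps s have "mono_of s \<in> ideal_of M" by blast
      then have "mono_of u * mono_of s \<in> ideal_of M" by (rule idl.span_scale)
      then show ?thesis by (simp add: mono_of_mult u add.commute)
    qed
  qed
  then have "A \<subseteq> ideal_of M"
    using A by (force simp: monomial_def intro: idl.span_base)
  then have "J \<subseteq> ideal_of M"
    unfolding A(2) by (intro idl.span_minimal) auto
  moreover have "ideal_of M \<subseteq> J"
    by (intro idl.span_minimal) (auto simp: M_def A(2))
  ultimately show "ideal_of M = J" by blast
  fix B :: "('n, 'k) mpoly set"
  assume B: "\<forall>m\<in>B. monomial m" "ideal_of B = J"
  show "M \<subseteq> B"
  proof
    fix m assume m: "m \<in> M"
    then obtain t where t: "m = mono_of t" by (auto simp: M_def monomial_def)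
    have "m \<in> ideal_of B" using m B by (simp add: M_def)
    from keys_ideal_of_monomials[OF this B(1), of t]
    obtain s u where s: "mono_of s \<in> B" "t = s + u" by (auto simp: t)
    then have "mono_of s \<in> J" "(mono_of s :: ('n, 'k) mpoly) dvd m"
      using B idl.span_base by (auto simp: t mono_of_dvd_iff)
    then have "mono_of s = m" using m by (auto simp: M_def monomial_def)
    with s show "m \<in> B" by simp
  qed
qed

lemma is_min_mono_gens_iff:
  fixes J :: "('n::finite, 'k::field) mpoly set"
  assumes "monomial_ideal J"
  shows "is_min_mono_gens B J \<longleftrightarrow>
    B = {m \<in> J. monomial m \<and> (\<forall>m'\<in>J. monomial m' \<and> m' dvd m \<longrightarrow> m' = m)}" (is "_ \<longleftrightarrow> B = ?M")
proof -
  define M where "M = ?M"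
  have least: "M \<subseteq> C" if "\<forall>m\<in>C. monomial m" "ideal_of C = J" for C
    unfolding M_def by (rule min_mono_gens_aux(2)[OF assms that])
  have M: "ideal_of M = J" "\<forall>m\<in>M. monomial m"
    using min_mono_gens_aux(1)[OF assms] unfolding M_def by simp_all
  have "is_min_mono_gens B J \<longleftrightarrow> B = M"
  proof
    assume B: "is_min_mono_gens B J"
    then have "M \<subseteq> B" by (intro least) (simp_all add: is_min_mono_gens_def)
    moreover have "\<not> M \<subset> B" using B M(1) unfolding is_min_mono_gens_def by blast
    ultimately show "B = M" by blast
  next
    assume B: "B = M"
    have "ideal_of C \<noteq> J" if "C \<subset> M" for C
    proof
      assume "ideal_of C = J"
      moreover have "\<forall>m\<in>C. monomial m" using that M(2) by blast
      ultimately have "M \<subseteq> C" by (intro least)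
      with that show False by blast
    qed
    then show "is_min_mono_gens B J" using M B unfolding is_min_mono_gens_def by blast
  qed
  then show ?thesis by (simp only: M_def)
qed

lemma min_mono_gens_eq:
  fixes J :: "('n::finite, 'k::field) mpoly set"
  assumes "monomial_ideal J"
  shows "min_mono_gens J = {m \<in> J. monomial m \<and> (\<forall>m'\<in>J. monomial m' \<and> m' dvd m \<longrightarrow> m' = m)}"
  unfolding min_mono_gens_def is_min_mono_gens_iff[OF assms] by simp

lemma ideal_of_times_image:
  fixes A :: "'a::comm_ring_1 set"
  shows "ideal_of ((*) c ` A) = c *o ideal_of A"
proof (rule equalityI)
  have "is_ideal (c *o ideal_of A)"
  proof (rule idl.subspaceI)
    show "0 \<in> c *o ideal_of A"
      using set_times_intro2[OF idl.span_zero, of c A] by simp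
  next
    fix x y assume "x \<in> c *o ideal_of A" "y \<in> c *o ideal_of A"
    then obtain u v where uv: "u \<in> ideal_of A" "x = c * u" "v \<in> ideal_of A" "y = c * v"
      unfolding elt_set_times_def by blast
    then have "c * (u + v) \<in> c *o ideal_of A"
      by (intro set_times_intro2 idl.span_add)
    then show "x + y \<in> c *o ideal_of A" by (simp add: uv distrib_left)
  next
    fix d x assume "x \<in> c *o ideal_of A"
    then obtain u where u: "u \<in> ideal_of A" "x = c * u"
      unfolding elt_set_times_def by blast
    then have "c * (d * u) \<in> c *o ideal_of A"
      by (intro set_times_intro2 idl.span_scale)
    then show "d * x \<in> c *o ideal_of A" by (simp add: u mult.left_commute)
  qed
  moreover have "(*) c ` A \<subseteq> c *o ideal_of A"
    using idl.span_superset unfolding elt_set_times_def by blast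
  ultimately show "ideal_of ((*) c ` A) \<subseteq> c *o ideal_of A"
    by (intro idl.span_minimal)
next
  have "c * x \<in> ideal_of ((*) c ` A)" if "x \<in> ideal_of A" for x
    using that
  proof (induction rule: idl.span_induct_alt)
    case base
    show ?case by (simp add: idl.span_zero)
  next
    case (step d y z)
    from step.hyps have "c * y \<in> ideal_of ((*) c ` A)"
      by (intro idl.span_base imageI)
    then have "d * (c * y) + c * z \<in> ideal_of ((*) c ` A)"
      using step.IH by (blast intro: idl.span_add idl.span_scale)
    then show ?case by (simp add: distrib_left mult.left_commute)
  qed
  then show "c *o ideal_of A \<subseteq> ideal_of ((*) c ` A)"
    unfolding elt_set_times_def by blast
qed

lemma squarefree_monomial_imp_monomial: "squarefree_monomial m \<Longrightarrow> monomial m"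
  by (auto simp: squarefree_monomial_def monomial_def)

lemma squarefree_monomial_Var: "squarefree_monomial (Var i)"
  unfolding squarefree_monomial_def Var_def
  by (rule exI[of _ "Poly_Mapping.single i 1"]) (auto simp: lookup_single when_def)

lemma critical_squarefree_monomial_ideal:
  fixes I :: "('n::finite, 'k::field) mpoly set"
  assumes "critical I"
  shows "squarefree_monomial_ideal I"
  using assms
proof induction
  case (base m i)
  then show ?case
    unfolding squarefree_monomial_ideal_def
    by (intro exI[of _ "{Var i, m}"]) (auto simp: squarefree_monomial_Var)
next
  case (step J m' j)
  obtain A where A: "\<forall>m\<in>A. squarefree_monomial m" "J = ideal_of A"
    using step.IH by (auto simp: squarefree_monomial_ideal_def)
  then have mA: "\<forall>m\<in>A. monomial m" by (auto intro: squarefree_monomial_imp_monomial)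
  then have J: "monomial_ideal J" using A by (auto simp: monomial_ideal_def)
  let ?G = "min_mono_gens J"
  have G: "ideal_of ?G = J" "?G \<subseteq> A"
    using min_mono_gens_aux[OF J] min_mono_gens_eq[OF J] A mA by auto
  have "squarefree_monomial (m' * m)" if m: "m \<in> ?G" for m
  proof -
    have "squarefree_monomial m" using m G(2) A(1) by blast
    then obtain s where s: "m = mono_of s" "\<forall>i. Poly_Mapping.lookup s i \<le> 1"
      unfolding squarefree_monomial_def by blast
    obtain t where t: "m' = mono_of t" "\<forall>i. Poly_Mapping.lookup t i \<le> 1"
      using step.hyps(2) unfolding squarefree_monomial_def by blast
    have "supp m \<inter> supp m' = {}" using step.hyps m by blast
    then have "Poly_Mapping.lookup s i = 0 \<or> Poly_Mapping.lookup t i = 0" for i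
      by (auto simp: supp_def s t Var_dvd_mono_of_iff)
    then have "Poly_Mapping.lookup (t + s) i \<le> 1" for i
      using s(2) t(2) by (metis add.left_neutral add.right_neutral lookup_add)
    then show ?thesis by (auto simp: squarefree_monomial_def s t mono_of_mult)
  qed
  moreover have "ideal_of {Var j} + m' *o J = ideal_of ({Var j} \<union> (*) m' ` ?G)"
    unfolding idl.span_Un ideal_of_times_image G set_plus_def by blast
  ultimately show ?case
    unfolding squarefree_monomial_ideal_def
    by (intro exI[of _ "{Var j} \<union> (*) m' ` ?G"]) (auto simp: squarefree_monomial_Var)
qed

end

theory Submission
  imports Defs
begin

text \<open>
  For a set \<open>V\<close> of variables let \<open>I\<^sub>V\<^sub>,\<^sub>d\<close> be the ideal of \<open>S\<close> generated by the monomials of degree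
  \<open>d\<close> in \<open>I\<close> that involve only variables from \<open>V\<close>. One shows that \<open>I\<^sub>V\<^sub>,\<^sub>d\<close> has a \<open>d\<close>-linear
  resolution for all \<open>V\<close> and \<open>d\<close>; the case \<open>V = {x\<^sub>1,\<dots>,x\<^sub>n}\<close> is componentwise linearity.
  If \<open>x \<in> V\<close> and \<open>x \<in> I\<close>, then \<open>I\<^sub>V\<^sub>,\<^sub>d\<^sub>+\<^sub>1 = x S\<^sub>V\<^sub>,\<^sub>d + I\<^sub>W\<^sub>,\<^sub>d\<^sub>+\<^sub>1\<close> with \<open>W = V - {x}\<close>, and
  \<open>x\<close> is a nonzerodivisor modulo \<open>I\<^sub>W\<^sub>,\<^sub>d\<^sub>+\<^sub>1 \<subseteq> S\<^sub>V\<^sub>,\<^sub>d\<close>, so a mapping cone of linear resolutions of the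
  two pieces is a linear resolution. With \<open>I = S\<close> this gives the claim for \<open>S\<close> by induction on
  \<open>V\<close> and \<open>d\<close>. If \<open>x \<notin> V\<close>, then \<open>((x) + m' J)\<^sub>V\<^sub>,\<^sub>d = (m' J)\<^sub>V\<^sub>,\<^sub>d\<close>, which is zero or
  \<open>m' J\<^sub>V\<^sub>,\<^sub>e\<close> with \<open>e = d - deg m'\<close>; hence the claim passes from \<open>J\<close> to \<open>(x) + m' J\<close>.
\<close>

subsection \<open>Monomials and homogeneous polynomials\<close>

lemma mdeg_add: "mdeg (s + t) = mdeg s + mdeg t"
  by (simp add: mdeg_def lookup_add sum.distrib)

lemma mdeg_single: "mdeg (Poly_Mapping.single i n) = n"
  by (simp add: mdeg_def lookup_single when_def)

lemma mdeg_eq_0_iff: "mdeg t = 0 \<longleftrightarrow> t = 0"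
  by (auto simp: mdeg_def intro: poly_mapping_eqI)

lemma lookup_pos_obtains:
  fixes t :: "'n \<Rightarrow>\<^sub>0 nat"
  assumes "0 < Poly_Mapping.lookup t i"
  obtains u where "t = Poly_Mapping.single i 1 + u"
proof
  show "t = Poly_Mapping.single i 1 + (t - Poly_Mapping.single i 1)"
    using assms by (intro poly_mapping_eqI) (auto simp: lookup_add lookup_minus lookup_single when_def)
qed

lemma mdeg_pos_obtains:
  assumes "0 < mdeg t"
  obtains i u where "i \<in> Poly_Mapping.keys t" "t = Poly_Mapping.single i 1 + u"
proof -
  from assms have "t \<noteq> 0" using mdeg_eq_0_iff[of t] by auto
  then obtain i where i: "i \<in> Poly_Mapping.keys t" by (metis keys_eq_empty ex_in_conv)
  then have "0 < Poly_Mapping.lookup t i" by (simp add: in_keys_iff)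
  with i that show thesis by (metis lookup_pos_obtains)
qed

lemma keys_add_nat:
  fixes s t :: "'n \<Rightarrow>\<^sub>0 nat"
  shows "Poly_Mapping.keys (s + t) = Poly_Mapping.keys s \<union> Poly_Mapping.keys t"
  by (auto simp: in_keys_iff lookup_add)

text \<open>Multiplication by a monomial shifts exponents injectively, so no coefficients get mixed.
  Cancellation of monomials and the colon argument for a variable both rest on this.\<close>

lemma lookup_mono_of_mult:
  fixes f :: "('n, 'k::field) mpoly"
  shows "Poly_Mapping.lookup (mono_of s * f) (s + t) = Poly_Mapping.lookup f t"
proof -
  have "(\<Sum>q. Poly_Mapping.lookup f q when s + t = s + q) = Poly_Mapping.lookup f t"
    by (simp)
  moreover have "(mono_of s * f) = Poly_Mapping.single s 1 * f" by (simp add: mono_of_def)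
  ultimately show ?thesis
    by (simp add: lookup_mult lookup_single when_mult)
qed

lemma mono_of_mult_cancel:
  fixes f g :: "('n, 'k::field) mpoly"
  assumes "mono_of s * f = mono_of s * g"
  shows "f = g"
  by (rule poly_mapping_eqI) (metis assms lookup_mono_of_mult)

lemma poly_mapping_eq_sum_mono_of:
  fixes f :: "('n, 'k::field) mpoly"
  shows "f = (\<Sum>t\<in>Poly_Mapping.keys f. Poly_Mapping.single 0 (Poly_Mapping.lookup f t) * mono_of t)"
  by (rule poly_mapping_eqI)
     (auto simp: lookup_sum mono_of_def mult_single lookup_single when_def in_keys_iff)

lemma mem_ideal_if_keys:
  fixes f :: "('n, 'k::field) mpoly"
  assumes "\<And>t. t \<in> Poly_Mapping.keys f \<Longrightarrow> mono_of t \<in> ideal_of A"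
  shows "f \<in> ideal_of A"
  by (subst poly_mapping_eq_sum_mono_of) (intro idl.span_sum idl.span_scale assms)

lemma mono_of_mem_ideal_iff:
  fixes T :: "('n \<Rightarrow>\<^sub>0 nat) set"
  shows "(mono_of t :: ('n, 'k::field) mpoly) \<in> ideal_of (mono_of ` T) \<longleftrightarrow> (\<exists>s\<in>T. \<exists>u. t = s + u)"
proof
  assume "(mono_of t :: ('n, 'k) mpoly) \<in> ideal_of (mono_of ` T)"
  from keys_ideal_of_monomials[OF this, of t] show "\<exists>s\<in>T. \<exists>u. t = s + u"
    by (auto simp: monomial_def)
next
  assume "\<exists>s\<in>T. \<exists>u. t = s + u"
  then obtain s u where "s \<in> T" "t = u + s" by (metis add.commute)
  then show "(mono_of t :: ('n, 'k) mpoly) \<in> ideal_of (mono_of ` T)"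
    by (auto simp: mono_of_mult[symmetric] intro: idl.span_scale idl.span_base)
qed

text \<open>Every term of an element is a multiple of a generator, because the generators are
  monomials. Membership thus reduces to divisibility of monomials.\<close>

lemma mem_monomial_ideal_iff:
  fixes f :: "('n, 'k::field) mpoly"
  assumes "monomial_ideal I"
  shows "f \<in> I \<longleftrightarrow> (\<forall>t\<in>Poly_Mapping.keys f. mono_of t \<in> I)"
proof -
  obtain A where A: "\<forall>m\<in>A. monomial m" "I = ideal_of A"
    using assms by (auto simp: monomial_ideal_def)
  have "mono_of t \<in> I" if "f \<in> I" "t \<in> Poly_Mapping.keys f" for t
  proof -
    have "f \<in> ideal_of A" using that A by simp
    from keys_ideal_of_monomials[OF this A(1) that(2)]
    obtain s u where "mono_of s \<in> A" "t = u + s" by (metis add.commute)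
    then show ?thesis
      by (auto simp: A(2) mono_of_mult[symmetric] intro: idl.span_scale idl.span_base)
  qed
  then show ?thesis using mem_ideal_if_keys[of f A] A(2) by auto
qed

lemma monomial_ideal_mono_of_image: "monomial_ideal (ideal_of (mono_of ` T))"
  unfolding monomial_ideal_def by (rule exI[of _ "mono_of ` T"]) (auto simp: monomial_def)

lemma homogeneous_0 [simp]: "homogeneous d 0"
  by (simp add: homogeneous_def)

lemma homogeneous_mono_of: "homogeneous (int (mdeg t)) (mono_of t)"
  by (simp add: homogeneous_def)

lemma homogeneous_1: "homogeneous 0 1"
  by (simp add: homogeneous_def mdeg_eq_0_iff)

lemma homogeneous_uminus: "homogeneous d f \<Longrightarrow> homogeneous d (- f)"
  by (auto simp: homogeneous_def in_keys_iff)

lemma homogeneous_mult: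
  assumes "homogeneous d f" "homogeneous e g"
  shows "homogeneous (d + e) (f * g)"
  using assms keys_mult[of f g] by (fastforce simp: homogeneous_def mdeg_add)

lemma homogeneous_diff:
  assumes "homogeneous d f" "homogeneous d g"
  shows "homogeneous d (f - g)"
  using assms by (auto simp: homogeneous_def in_keys_iff lookup_minus)

lemma keys_sum_subset: "Poly_Mapping.keys (sum f A) \<subseteq> (\<Union>i\<in>A. Poly_Mapping.keys (f i))"
proof (induction A rule: infinite_finite_induct)
  case (insert x F)
  then show ?case using keys_add[of "f x" "sum f F"] by auto
qed auto

lemma homogeneous_sum:
  assumes "\<And>i. i \<in> A \<Longrightarrow> homogeneous d (f i)"
  shows "homogeneous d (sum f A)"
  using assms keys_sum_subset[of f A] by (fastforce simp: homogeneous_def)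

text \<open>This makes linear resolutions minimal: all their matrices after the augmentation have
  entries of degree 1.\<close>

lemma homogeneous_1_mem_irrelevant_ideal:
  fixes f :: "('n::finite, 'k::field) mpoly"
  assumes "homogeneous 1 f"
  shows "f \<in> ideal_of (range Var)"
proof (rule mem_ideal_if_keys)
  fix t assume "t \<in> Poly_Mapping.keys f"
  with assms have "0 < mdeg t" by (fastforce simp: homogeneous_def)
  then obtain i u where "t = u + Poly_Mapping.single i 1" by (metis mdeg_pos_obtains add.commute)
  then have "(mono_of t :: ('n, 'k) mpoly) = mono_of u * Var i" by (simp add: mono_of_mult Var_def)
  then show "(mono_of t :: ('n, 'k) mpoly) \<in> ideal_of (range Var)"
    by (simp add: idl.span_scale idl.span_base)
qed

text \<open>\<open>f1\<close> is the component of degree \<open>e\<close>, cut out by setting all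
  other coefficients to zero; finite support is inherited from \<open>f\<close>.\<close>

lemma homogeneous_part_exists:
  fixes f :: "('n::finite, 'k::field) mpoly"
  shows "\<exists>f1. homogeneous e f1 \<and> (\<forall>t\<in>Poly_Mapping.keys (f - f1). int (mdeg t) \<noteq> e)"
proof -
  have "finite {t. (Poly_Mapping.lookup f t when int (mdeg t) = e) \<noteq> 0}"
    by (rule finite_subset[OF _ finite_lookup[of f]]) (auto simp: when_def)
  then have "Poly_Mapping.lookup (Abs_poly_mapping (\<lambda>t. Poly_Mapping.lookup f t when int (mdeg t) = e)) t
      = (Poly_Mapping.lookup f t when int (mdeg t) = e)" for t
    by simp
  then show ?thesis
    by (intro exI[of _ "Abs_poly_mapping (\<lambda>t. Poly_Mapping.lookup f t when int (mdeg t) = e)"])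
       (auto simp: homogeneous_def in_keys_iff lookup_minus when_def split: if_splits)
qed


subsection \<open>Exact sequences of matrices\<close>

lemma mult_mat_vec_smult:
  fixes A :: "'a::comm_ring_1 mat"
  assumes "A \<in> carrier_mat n m" "v \<in> carrier_vec m"
  shows "A *\<^sub>v (k \<cdot>\<^sub>v v) = k \<cdot>\<^sub>v (A *\<^sub>v v)"
  using assms by (intro eq_vecI) auto

lemma mult_mat_vec_uminus:
  fixes A :: "'a::comm_ring_1 mat"
  assumes "A \<in> carrier_mat n m" "v \<in> carrier_vec m"
  shows "A *\<^sub>v (- v) = - (A *\<^sub>v v)"
  using assms by (intro eq_vecI) auto

lemma smult_mat_mult_vec:
  fixes A :: "'a::comm_ring_1 mat"
  assumes "A \<in> carrier_mat n m" "v \<in> carrier_vec m"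
  shows "(k \<cdot>\<^sub>m A) *\<^sub>v v = k \<cdot>\<^sub>v (A *\<^sub>v v)"
  using assms by (intro eq_vecI) auto

lemma mult_mat_vec_zero:
  fixes A :: "'a::comm_ring_1 mat"
  assumes "A \<in> carrier_mat n m"
  shows "A *\<^sub>v 0\<^sub>v m = 0\<^sub>v n"
  using assms by (intro eq_vecI) auto

lemma zero_mat_mult_vec:
  fixes v :: "'a::comm_ring_1 vec"
  assumes "v \<in> carrier_vec m"
  shows "0\<^sub>m n m *\<^sub>v v = 0\<^sub>v n"
  using assms by (intro eq_vecI) auto

lemma mult_unit_vec_eq_col:
  fixes A :: "'a::comm_ring_1 mat"
  assumes "A \<in> carrier_mat n m" "q < m"
  shows "A *\<^sub>v unit_vec m q = col A q"
  using assms by (intro eq_vecI) auto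

lemma zero_vec_append: "0\<^sub>v (n + m) = 0\<^sub>v n @\<^sub>v 0\<^sub>v m"
  by (intro eq_vecI) auto

lemma carrier_vec_append_obtains:
  assumes "v \<in> carrier_vec (n + m)"
  obtains u w where "v = u @\<^sub>v w" "u \<in> carrier_vec n" "w \<in> carrier_vec m"
  using vec_first_last_append[OF assms] by (metis vec_first_carrier vec_last_carrier)

lemma exact_mult_eq_zero:
  assumes "mat_kernel A = (\<lambda>w. B *\<^sub>v w) ` carrier_vec k" "A \<in> carrier_mat n m" "w \<in> carrier_vec k"
  shows "A *\<^sub>v (B *\<^sub>v w) = 0\<^sub>v n"
  using assms mat_kernelD(2)[OF assms(2)] by blast

lemma exact_preimage_obtains:
  assumes "mat_kernel A = (\<lambda>w. B *\<^sub>v w) ` carrier_vec k" "A \<in> carrier_mat n m" "v \<in> carrier_vec m"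
    and "A *\<^sub>v v = 0\<^sub>v n"
  obtains w where "w \<in> carrier_vec k" "v = B *\<^sub>v w"
  using assms(1) mat_kernelI[OF assms(2-4)] that by blast

text \<open>A diagram chase: for \<open>(u, w)\<close> in the kernel write \<open>w = K w'\<close>
  by \<open>lift\<close>; then \<open>u + \<psi>' w'\<close> lies in the kernel of \<open>P\<close>,
  hence in the image of \<open>Q\<close>. The hypothesis \<open>lift\<close> stands in for exactness
  at \<open>J\<close>, \<open>K\<close>, because in the lowest cone step \<open>J\<close> has no
  rows and the condition on \<open>w\<close> must come from the first block.\<close>

lemma mapping_cone_exact:
  fixes P Q \<psi> \<psi>' J K :: "'a::comm_ring_1 mat"
  assumes P: "P \<in> carrier_mat m0 m1" and Q: "Q \<in> carrier_mat m1 m2"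
    and \<psi>: "\<psi> \<in> carrier_mat m0 k0" and \<psi>': "\<psi>' \<in> carrier_mat m1 k1"
    and J: "J \<in> carrier_mat j k0" and K: "K \<in> carrier_mat k0 k1"
    and exact: "mat_kernel P = (\<lambda>w. Q *\<^sub>v w) ` carrier_vec m2"
    and comm: "\<And>w. w \<in> carrier_vec k1 \<Longrightarrow> P *\<^sub>v (\<psi>' *\<^sub>v w) = \<psi> *\<^sub>v (K *\<^sub>v w)"
    and JK: "\<And>w. w \<in> carrier_vec k1 \<Longrightarrow> J *\<^sub>v (K *\<^sub>v w) = 0\<^sub>v j"
    and lift: "\<And>u w. u \<in> carrier_vec m1 \<Longrightarrow> w \<in> carrier_vec k0 \<Longrightarrow> P *\<^sub>v u + \<psi> *\<^sub>v w = 0\<^sub>v m0 \<Longrightarrow>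
      J *\<^sub>v w = 0\<^sub>v j \<Longrightarrow> \<exists>w'\<in>carrier_vec k1. w = K *\<^sub>v w'"
  shows "mat_kernel (four_block_mat P \<psi> (0\<^sub>m j m1) (- J)) =
    (\<lambda>v. four_block_mat Q \<psi>' (0\<^sub>m k0 m2) (- K) *\<^sub>v v) ` carrier_vec (m2 + k1)"
    (is "mat_kernel ?D = (\<lambda>v. ?E *\<^sub>v v) ` _")
proof -
  have D: "?D \<in> carrier_mat (m0 + j) (m1 + k0)" using P J by simp
  have E: "?E \<in> carrier_mat (m1 + k0) (m2 + k1)" using Q K by simp
  have Dv: "?D *\<^sub>v (u @\<^sub>v w) = (P *\<^sub>v u + \<psi> *\<^sub>v w) @\<^sub>v (- (J *\<^sub>v w))"
    if "u \<in> carrier_vec m1" "w \<in> carrier_vec k0" for u w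
    using four_block_mat_mult_vec[OF P \<psi> zero_carrier_mat uminus_carrier_mat[OF J] that] that J
    by (simp add: zero_mat_mult_vec)
  have Ev: "?E *\<^sub>v (u @\<^sub>v w) = (Q *\<^sub>v u + \<psi>' *\<^sub>v w) @\<^sub>v (- (K *\<^sub>v w))"
    if "u \<in> carrier_vec m2" "w \<in> carrier_vec k1" for u w
    using four_block_mat_mult_vec[OF Q \<psi>' zero_carrier_mat uminus_carrier_mat[OF K] that] that K
    by (simp add: zero_mat_mult_vec)
  show ?thesis
  proof (intro equalityI subsetI)
    fix v assume v: "v \<in> mat_kernel ?D"
    from mat_kernelD[OF D v] obtain u w where v_eq: "v = u @\<^sub>v w"
      and u: "u \<in> carrier_vec m1" and w: "w \<in> carrier_vec k0"
      and zero: "?D *\<^sub>v (u @\<^sub>v w) = 0\<^sub>v (m0 + j)"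
      by (metis carrier_vec_append_obtains)
    from zero have 1: "P *\<^sub>v u + \<psi> *\<^sub>v w = 0\<^sub>v m0" and 2: "- (J *\<^sub>v w) = 0\<^sub>v j"
      using append_vec_eq[of "P *\<^sub>v u + \<psi> *\<^sub>v w" m0 "0\<^sub>v m0"] P \<psi> u w
      by (auto simp: Dv[OF u w] zero_vec_append)
    have "J *\<^sub>v w = 0\<^sub>v j" using 2 uminus_zero_vec_eq[of "J *\<^sub>v w" j] J w by simp
    with lift[OF u w 1] obtain w' where w': "w' \<in> carrier_vec k1" "w = K *\<^sub>v w'" by blast
    have "P *\<^sub>v (u + \<psi>' *\<^sub>v w') = 0\<^sub>v m0"
      using 1 w' P \<psi>' u by (simp add: mult_add_distrib_mat_vec[of P m0 m1] comm)
    then obtain u' where u': "u' \<in> carrier_vec m2" "u + \<psi>' *\<^sub>v w' = Q *\<^sub>v u'"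
      using exact_preimage_obtains[OF exact P, of "u + \<psi>' *\<^sub>v w'"] u w' \<psi>' by auto
    \<comment> \<open>The block \<open>- K\<close> carries a sign, so the preimage is
      \<open>(u', - w')\<close>.\<close>
    have "u = Q *\<^sub>v u' + \<psi>' *\<^sub>v (- w')"
      unfolding u'(2)[symmetric] mult_mat_vec_uminus[OF \<psi>' w'(1)]
      using u w' \<psi>' by (intro eq_vecI) auto
    moreover have "w = - (K *\<^sub>v (- w'))"
      using w' K by (simp add: mult_mat_vec_uminus)
    ultimately have "v = ?E *\<^sub>v (u' @\<^sub>v (- w'))"
      using u' w' by (simp add: v_eq Ev)
    then show "v \<in> (\<lambda>v. ?E *\<^sub>v v) ` carrier_vec (m2 + k1)" using u' w' by auto
  next
    fix v assume "v \<in> (\<lambda>v. ?E *\<^sub>v v) ` carrier_vec (m2 + k1)"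
    then obtain u w where v: "v = ?E *\<^sub>v (u @\<^sub>v w)" and u: "u \<in> carrier_vec m2" and w: "w \<in> carrier_vec k1"
      by (auto elim!: carrier_vec_append_obtains)
    have "?D *\<^sub>v v = (P *\<^sub>v (Q *\<^sub>v u + \<psi>' *\<^sub>v w) + \<psi> *\<^sub>v (- (K *\<^sub>v w))) @\<^sub>v (- (J *\<^sub>v (- (K *\<^sub>v w))))"
      unfolding v Ev[OF u w] by (rule Dv) (use Q \<psi>' K u w in auto)
    also have "P *\<^sub>v (Q *\<^sub>v u + \<psi>' *\<^sub>v w) = \<psi> *\<^sub>v (K *\<^sub>v w)"
      using P Q \<psi> \<psi>' K u w
      by (simp add: mult_add_distrib_mat_vec[of P m0 m1] exact_mult_eq_zero[OF exact P] comm)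
    also have "\<psi> *\<^sub>v (- (K *\<^sub>v w)) = - (\<psi> *\<^sub>v (K *\<^sub>v w))"
      using \<psi> K w by (simp add: mult_mat_vec_uminus)
    also have "J *\<^sub>v (- (K *\<^sub>v w)) = - 0\<^sub>v j"
      using J K w by (subst mult_mat_vec_uminus[OF J]) (auto simp: JK)
    also have "(\<psi> *\<^sub>v (K *\<^sub>v w) + - (\<psi> *\<^sub>v (K *\<^sub>v w))) @\<^sub>v (- (- 0\<^sub>v j)) = 0\<^sub>v (m0 + j)"
      using uminus_r_inv_vec[OF mult_mat_vec_carrier[OF \<psi> mult_mat_vec_carrier[OF K w]]]
      by (simp add: zero_vec_append)
    finally have zero: "?D *\<^sub>v v = 0\<^sub>v (m0 + j)" .
    have "v \<in> carrier_vec (m1 + k0)"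
      unfolding v using E u w by (metis append_carrier_vec mult_mat_vec_carrier)
    with zero show "v \<in> mat_kernel ?D" by (intro mat_kernelI[OF D])
  qed
qed

lemma block_diag_exact:
  fixes A B A' B' :: "'a::comm_ring_1 mat"
  assumes A: "A \<in> carrier_mat n0 n1" and A': "A' \<in> carrier_mat n1 n2"
    and B: "B \<in> carrier_mat m0 m1" and B': "B' \<in> carrier_mat m1 m2"
    and exA: "mat_kernel A = (*\<^sub>v) A' ` carrier_vec n2" and exB: "mat_kernel B = (*\<^sub>v) B' ` carrier_vec m2"
  shows "mat_kernel (four_block_mat A (0\<^sub>m n0 m1) (0\<^sub>m m0 n1) B) =
    (*\<^sub>v) (four_block_mat A' (0\<^sub>m n1 m2) (0\<^sub>m m1 n2) B') ` carrier_vec (n2 + m2)"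
    (is "mat_kernel ?D = (*\<^sub>v) ?E ` _")
proof -
  have D: "?D \<in> carrier_mat (n0 + m0) (n1 + m1)" using A B by simp
  have E: "?E \<in> carrier_mat (n1 + m1) (n2 + m2)" using A' B' by simp
  have Dv: "?D *\<^sub>v (u @\<^sub>v v) = (A *\<^sub>v u) @\<^sub>v (B *\<^sub>v v)" if "u \<in> carrier_vec n1" "v \<in> carrier_vec m1" for u v
    using four_block_mat_mult_vec[OF A zero_carrier_mat zero_carrier_mat B that] that A B
    by (simp add: zero_mat_mult_vec)
  have Ev: "?E *\<^sub>v (u @\<^sub>v v) = (A' *\<^sub>v u) @\<^sub>v (B' *\<^sub>v v)" if "u \<in> carrier_vec n2" "v \<in> carrier_vec m2" for u v
    using four_block_mat_mult_vec[OF A' zero_carrier_mat zero_carrier_mat B' that] that A' B'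
    by (simp add: zero_mat_mult_vec)
  show ?thesis
  proof (intro equalityI subsetI)
    fix w assume w: "w \<in> mat_kernel ?D"
    from mat_kernelD[OF D w] obtain u v where w_eq: "w = u @\<^sub>v v"
      and u: "u \<in> carrier_vec n1" and v: "v \<in> carrier_vec m1"
      and zero: "?D *\<^sub>v (u @\<^sub>v v) = 0\<^sub>v (n0 + m0)"
      by (metis carrier_vec_append_obtains)
    have "A *\<^sub>v u = 0\<^sub>v n0 \<and> B *\<^sub>v v = 0\<^sub>v m0"
      using zero append_vec_eq[of "A *\<^sub>v u" n0 "0\<^sub>v n0"] mult_mat_vec_carrier[OF A u]
      by (simp add: Dv[OF u v] zero_vec_append)
    then obtain u' v' where "u' \<in> carrier_vec n2" "u = A' *\<^sub>v u'" "v' \<in> carrier_vec m2" "v = B' *\<^sub>v v'"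
      using exact_preimage_obtains[OF exA A u] exact_preimage_obtains[OF exB B v] by metis
    then show "w \<in> (*\<^sub>v) ?E ` carrier_vec (n2 + m2)"
      by (intro image_eqI[of _ _ "u' @\<^sub>v v'"]) (simp_all add: w_eq Ev)
  next
    fix w assume "w \<in> (*\<^sub>v) ?E ` carrier_vec (n2 + m2)"
    then obtain u v where w: "w = ?E *\<^sub>v (u @\<^sub>v v)" and u: "u \<in> carrier_vec n2" and v: "v \<in> carrier_vec m2"
      by (auto elim!: carrier_vec_append_obtains)
    have "?D *\<^sub>v w = 0\<^sub>v (n0 + m0)"
      unfolding w Ev[OF u v] Dv[OF mult_mat_vec_carrier[OF A' u] mult_mat_vec_carrier[OF B' v]]
        exact_mult_eq_zero[OF exA A u] exact_mult_eq_zero[OF exB B v] by (simp add: zero_vec_append)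
    moreover have "w \<in> carrier_vec (n1 + m1)"
      unfolding w by (rule mult_mat_vec_carrier[OF E append_carrier_vec[OF u v]])
    ultimately show "w \<in> mat_kernel ?D" by (intro mat_kernelI[OF D])
  qed
qed


subsection \<open>Linear resolutions\<close>

lemma homogeneous_mult_mat_vec:
  assumes "A \<in> carrier_mat n m" "v \<in> carrier_vec m" "p < n"
    and "\<And>q. q < m \<Longrightarrow> homogeneous d (A $$ (p, q))"
    and "\<And>q. q < m \<Longrightarrow> homogeneous e (v $ q)"
  shows "homogeneous (d + e) ((A *\<^sub>v v) $ p)"
  using assms by (auto simp: scalar_prod_def intro!: homogeneous_sum homogeneous_mult)

text \<open>The parts of degree \<open>k\<close> of the coordinates of a solution form a solution.\<close>

lemma homogeneous_solution:
  fixes A :: "('n::finite, 'k::field) mpoly mat"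
  assumes A: "A \<in> carrier_mat n m" and u: "u \<in> carrier_vec m"
    and hA: "\<And>p q. p < n \<Longrightarrow> q < m \<Longrightarrow> homogeneous e (A $$ (p, q))"
    and hu: "\<And>p. p < n \<Longrightarrow> homogeneous (e + k) ((A *\<^sub>v u) $ p)"
  shows "\<exists>u'\<in>carrier_vec m. (\<forall>q<m. homogeneous k (u' $ q)) \<and> A *\<^sub>v u' = A *\<^sub>v u"
proof -
  obtain h where h: "\<And>q. homogeneous k (h q)"
    "\<And>q t. t \<in> Poly_Mapping.keys (u $ q - h q) \<Longrightarrow> int (mdeg t) \<noteq> k"
    using homogeneous_part_exists[of k "u $ _"] by metis
  define u' where "u' = vec m h"
  have u': "u' \<in> carrier_vec m" "\<forall>q<m. homogeneous k (u' $ q)" by (simp_all add: u'_def h)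
  have "A *\<^sub>v u' = A *\<^sub>v u"
  proof (rule eq_vecI)
    fix p assume "p < dim_vec (A *\<^sub>v u)"
    then have p: "p < n" using A by simp
    \<comment> \<open>All terms of \<open>D\<close> have degree \<open>e + k\<close>. Each of them
      also arises from an entry of degree \<open>e\<close> times a term of degree other than
      \<open>k\<close>, so \<open>D\<close> has no terms at all.\<close>
    define D where "D = (A *\<^sub>v u) $ p - (A *\<^sub>v u') $ p"
    have D: "D = (\<Sum>q = 0..<m. A $$ (p, q) * (u $ q - h q))"
      using A u p by (simp add: D_def u'_def scalar_prod_def right_diff_distrib sum_subtractf)
    have "homogeneous (e + k) D"
      unfolding D_def using hu[OF p] homogeneous_mult_mat_vec[OF A u'(1) p, of e k] hA p u'
      by (intro homogeneous_diff) auto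
    moreover have "int (mdeg t) \<noteq> e + k" if t: "t \<in> Poly_Mapping.keys D" for t
    proof -
      obtain q where q: "q < m" "t \<in> Poly_Mapping.keys (A $$ (p, q) * (u $ q - h q))"
        using subsetD[OF keys_sum_subset t[unfolded D]] by auto
      then obtain s s' where s: "t = s + s'" "s \<in> Poly_Mapping.keys (A $$ (p, q))"
        "s' \<in> Poly_Mapping.keys (u $ q - h q)"
        using keys_mult[of "A $$ (p, q)" "u $ q - h q"] by blast
      then have "int (mdeg s) = e" using hA[OF p q(1)] by (simp add: homogeneous_def)
      with s h(2) show ?thesis by (simp add: mdeg_add)
    qed
    ultimately have "Poly_Mapping.keys D = {}" by (auto simp: homogeneous_def)
    then have "D = 0" by (simp add: poly_mapping_eq_iff fun_eq_iff in_keys_iff set_eq_iff)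
    then show "(A *\<^sub>v u') $ p = (A *\<^sub>v u) $ p" by (simp add: D_def)
  qed (use A in simp)
  with u' show ?thesis by blast
qed

text \<open>Each column of \<open>N\<close> is solved for separately, the solution is replaced by
  its part of degree \<open>k\<close>, and these parts become the columns of \<open>M\<close>. It
  supplies the matrices of the comparison map.\<close>

lemma homogeneous_factorization:
  fixes A N :: "('n::finite, 'k::field) mpoly mat"
  assumes A: "A \<in> carrier_mat n m" and N: "N \<in> carrier_mat n l"
    and hA: "\<And>p q. p < n \<Longrightarrow> q < m \<Longrightarrow> homogeneous e (A $$ (p, q))"
    and hN: "\<And>p q. p < n \<Longrightarrow> q < l \<Longrightarrow> homogeneous (e + k) (N $$ (p, q))"
    and sol: "\<And>q. q < l \<Longrightarrow> \<exists>u\<in>carrier_vec m. col N q = A *\<^sub>v u"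
  shows "\<exists>M\<in>carrier_mat m l. (\<forall>p<m. \<forall>q<l. homogeneous k (M $$ (p, q))) \<and> A * M = N"
proof -
  have "\<exists>u\<in>carrier_vec m. (\<forall>p<m. homogeneous k (u $ p)) \<and> A *\<^sub>v u = col N q" if q: "q < l" for q
  proof -
    obtain u where u: "u \<in> carrier_vec m" "col N q = A *\<^sub>v u" using sol[OF q] by blast
    have "homogeneous (e + k) ((A *\<^sub>v u) $ p)" if "p < n" for p
      using hN[OF that q] u(2)[symmetric] N that q by simp
    from homogeneous_solution[OF A u(1) hA this] u(2) show ?thesis by metis
  qed
  then obtain U where U: "\<And>q. q < l \<Longrightarrow> U q \<in> carrier_vec m"
    "\<And>q p. q < l \<Longrightarrow> p < m \<Longrightarrow> homogeneous k (U q $ p)" "\<And>q. q < l \<Longrightarrow> A *\<^sub>v U q = col N q"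
    by metis
  define M where "M = mat m l (\<lambda>(p, q). U q $ p)"
  have M: "M \<in> carrier_mat m l" by (simp add: M_def)
  have "A * M = N"
  proof (rule mat_col_eqI)
    fix q assume "q < dim_col N"
    then have q: "q < l" using N by simp
    have "col M q = U q" using U(1)[OF q] q by (intro eq_vecI) (auto simp: M_def)
    then show "col (A * M) q = col N q" using U(3)[OF q] col_mult2[OF A M q] by simp
  qed (use A M N in auto)
  with M U show ?thesis by (intro bexI[of _ M]) (auto simp: M_def)
qed

lemma homogeneous_four_block_mat:
  assumes "A \<in> carrier_mat n1 m1" "B \<in> carrier_mat n1 m2" "C \<in> carrier_mat n2 m1" "D \<in> carrier_mat n2 m2"
    and "\<And>p q. p < n1 \<Longrightarrow> q < m1 \<Longrightarrow> homogeneous e (A $$ (p, q))"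
    and "\<And>p q. p < n1 \<Longrightarrow> q < m2 \<Longrightarrow> homogeneous e (B $$ (p, q))"
    and "\<And>p q. p < n2 \<Longrightarrow> q < m1 \<Longrightarrow> homogeneous e (C $$ (p, q))"
    and "\<And>p q. p < n2 \<Longrightarrow> q < m2 \<Longrightarrow> homogeneous e (D $$ (p, q))"
    and "p < n1 + n2" "q < m1 + m2"
  shows "homogeneous e (four_block_mat A B C D $$ (p, q))"
proof -
  have "dim_row A = n1" "dim_col A = m1" "dim_row D = n2" "dim_col D = m2" using assms(1,4) by auto
  then show ?thesis using assms(5-10) by simp
qed

text \<open>
  The complex is augmented: \<open>r 0 = 1\<close>, the one-row matrix \<open>\<delta> 0\<close> is the augmentation onto \<open>I\<close>, and
  the free module \<open>F\<^sub>i\<close> of the resolution has rank \<open>r (i + 1)\<close>.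
\<close>

definition linear_res ::
    "int \<Rightarrow> ('n::finite, 'k::field) mpoly set \<Rightarrow> (nat \<Rightarrow> nat) \<Rightarrow> (nat \<Rightarrow> ('n, 'k) mpoly mat) \<Rightarrow> bool"
  where "linear_res d I r \<delta> \<longleftrightarrow>
    r 0 = 1 \<and>
    (\<forall>i. \<delta> i \<in> carrier_mat (r i) (r (Suc i))) \<and>
    (\<forall>i. \<forall>p<r i. \<forall>q<r (Suc i). homogeneous (if i = 0 then d else 1) (\<delta> i $$ (p, q))) \<and>
    (\<forall>i. mat_kernel (\<delta> i) = (\<lambda>w. \<delta> (Suc i) *\<^sub>v w) ` carrier_vec (r (Suc (Suc i)))) \<and>
    (\<lambda>v. (\<delta> 0 *\<^sub>v v) $ 0) ` carrier_vec (r 1) = I"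

text \<open>The generating degree stays a parameter, because the mapping cone combines ideals
  generated in adjacent degrees.\<close>

definition linear_ideal :: "int \<Rightarrow> ('n::finite, 'k::field) mpoly set \<Rightarrow> bool"
  where "linear_ideal d I \<longleftrightarrow> (\<exists>r \<delta>. linear_res d I r \<delta>)"

lemma linear_resD:
  assumes "linear_res d I r \<delta>"
  shows "r 0 = 1" "\<delta> i \<in> carrier_mat (r i) (r (Suc i))"
    "p < r i \<Longrightarrow> q < r (Suc i) \<Longrightarrow> homogeneous (if i = 0 then d else 1) (\<delta> i $$ (p, q))"
    "mat_kernel (\<delta> i) = (\<lambda>w. \<delta> (Suc i) *\<^sub>v w) ` carrier_vec (r (Suc (Suc i)))"
    "(\<lambda>v. (\<delta> 0 *\<^sub>v v) $ 0) ` carrier_vec (r 1) = I"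
  using assms unfolding linear_res_def by blast+

lemma linear_res_mem:
  assumes "linear_res d I r \<delta>" "v \<in> carrier_vec (r (Suc 0))"
  shows "(\<delta> 0 *\<^sub>v v) $ 0 \<in> I"
  using linear_resD(5)[OF assms(1)] assms(2) by auto

lemma linear_res_mem_obtains:
  assumes "linear_res d I r \<delta>" "f \<in> I"
  obtains v where "v \<in> carrier_vec (r (Suc 0))" "(\<delta> 0 *\<^sub>v v) $ 0 = f"
  using linear_resD(5)[OF assms(1)] assms(2) by auto

lemma vec_1_eqI: "v \<in> carrier_vec 1 \<Longrightarrow> w \<in> carrier_vec 1 \<Longrightarrow> v $ 0 = w $ 0 \<Longrightarrow> v = w"
  by (intro eq_vecI) auto

text \<open>Removing the augmentation shifts indices by one: its only row becomes the vector of
  generators. Entries of degree 1 in the other matrices give both the shifts \<open>d + i\<close>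
  and minimality.\<close>

lemma linear_ideal_imp_has_linear_resolution:
  fixes I :: "('n::finite, 'k::field) mpoly set"
  assumes "linear_ideal d I"
  shows "has_linear_resolution I"
proof -
  obtain r \<delta> where L: "linear_res d I r \<delta>" using assms by (auto simp: linear_ideal_def)
  note LD = linear_resD[OF L]
  have hom: "homogeneous 1 (\<delta> (Suc i) $$ (p, q))" if "p < r (Suc i)" "q < r (Suc (Suc i))" for i p q
    using LD(3)[of p "Suc i" q] that by simp
  have row: "row (\<delta> 0) 0 \<bullet> v = (\<delta> 0 *\<^sub>v v) $ 0" for v
    using LD(1) LD(2)[of 0] by simp
  have "row (\<delta> 0) 0 \<bullet> v = 0 \<longleftrightarrow> \<delta> 0 *\<^sub>v v = 0\<^sub>v (r 0)" if "v \<in> carrier_vec (r (Suc 0))" for v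
  proof -
    have "w $ 0 = 0 \<longleftrightarrow> w = 0\<^sub>v (r 0)" if "w \<in> carrier_vec (r 0)" for w :: "('n, 'k) mpoly vec"
      using vec_1_eqI[of w "0\<^sub>v 1"] that LD(1) by auto
    from this[OF mult_mat_vec_carrier[OF LD(2)[of 0] that]] show ?thesis by (simp only: row)
  qed
  then have ker: "{v \<in> carrier_vec (r (Suc 0)). row (\<delta> 0) 0 \<bullet> v = 0} = mat_kernel (\<delta> 0)"
    unfolding mat_kernel[OF LD(2)[of 0]] by (intro Collect_cong) (rule conj_cong[OF refl])
  have "minimal_graded_free_resolution I (\<lambda>i. r (Suc i)) (\<lambda>i p. d + int i) (row (\<delta> 0) 0) (\<lambda>i. \<delta> (Suc i))"
    unfolding minimal_graded_free_resolution_def graded_free_resolution_def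
  proof (intro conjI allI impI)
    show "row (\<delta> 0) 0 \<in> carrier_vec (r (Suc 0))"
      using LD(2)[of 0] by (intro carrier_vecI) auto
    show "homogeneous (d + int 0) (row (\<delta> 0) 0 $ p)" if "p < r (Suc 0)" for p
      using LD(3)[of 0 0 p] LD(1) LD(2)[of 0] that by auto
    show "homogeneous (d + int (Suc i) - (d + int i)) (\<delta> (Suc i) $$ (p, q))"
      if "p < r (Suc i)" "q < r (Suc (Suc i))" for i p q
      using hom[OF that] by simp
    show "{v \<in> carrier_vec (r (Suc 0)). row (\<delta> 0) 0 \<bullet> v = 0} =
      (*\<^sub>v) (\<delta> (Suc 0)) ` carrier_vec (r (Suc 1))"
      unfolding ker LD(4) by simp
    show "\<delta> (Suc i) $$ (p, q) \<in> ideal_of (range Var)"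
      if "p < r (Suc i)" "q < r (Suc (Suc i))" for i p q
      by (rule homogeneous_1_mem_irrelevant_ideal[OF hom[OF that]])
    have "(\<bullet>) (row (\<delta> 0) 0) ` carrier_vec (r (Suc 0)) = (\<lambda>v. (\<delta> 0 *\<^sub>v v) $ 0) ` carrier_vec (r (Suc 0))"
      by (rule image_cong[OF refl row])
    then show "(\<bullet>) (row (\<delta> 0) 0) ` carrier_vec (r (Suc 0)) = I"
      using LD(5) by (simp only: One_nat_def)
  qed (rule LD(2) LD(4))+
  then show ?thesis unfolding has_linear_resolution_def by blast
qed

section \<open>Zero ideal, unit ideal and monomial multiples\<close>

lemma carrier_vec_0: "carrier_vec 0 = {0\<^sub>v 0 :: 'a::zero vec}"
  by auto

lemma mult_mat_vec_image_0:
  fixes A :: "'a::comm_ring_1 mat"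
  assumes "A \<in> carrier_mat n 0"
  shows "(*\<^sub>v) A ` carrier_vec 0 = {0\<^sub>v n}"
  unfolding carrier_vec_0 using mult_mat_vec_zero[OF assms] by auto

lemma mat_kernel_0_cols:
  fixes A :: "'a::comm_ring_1 mat"
  assumes "A \<in> carrier_mat n 0"
  shows "mat_kernel A = {0\<^sub>v 0}"
  unfolding mat_kernel[OF assms] carrier_vec_0 using mult_mat_vec_zero[OF assms] by auto

text \<open>All free modules vanish; the rank 1 at index 0 is only the target of the augmentation.
  The degree \<open>d\<close> is arbitrary, so empty levels are covered in every degree.\<close>

lemma linear_ideal_0: "linear_ideal d {0 :: ('n::finite, 'k::field) mpoly}"
proof -
  define r :: "nat \<Rightarrow> nat" where "r = (\<lambda>i. if i = 0 then 1 else 0)"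
  define \<delta> :: "nat \<Rightarrow> ('n, 'k) mpoly mat" where "\<delta> = (\<lambda>i. 0\<^sub>m (r i) 0)"
  have car: "\<delta> i \<in> carrier_mat (r i) 0" for i by (simp add: \<delta>_def)
  have r: "r (Suc i) = 0" for i by (simp add: r_def)
  have "linear_res d {0} r \<delta>"
    unfolding linear_res_def
  proof (intro conjI allI impI)
    show "mat_kernel (\<delta> i) = (*\<^sub>v) (\<delta> (Suc i)) ` carrier_vec (r (Suc (Suc i)))" for i
      unfolding r mat_kernel_0_cols[OF car] mult_mat_vec_image_0[OF car] by (simp add: r_def)
    have "(\<lambda>v. (\<delta> 0 *\<^sub>v v) $ 0) ` carrier_vec (r 1) = (\<lambda>w. w $ 0) ` ((*\<^sub>v) (\<delta> 0) ` carrier_vec 0)"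
      by (simp add: r_def image_image)
    also have "\<dots> = {0}" unfolding mult_mat_vec_image_0[OF car] by (simp add: r_def)
    finally show "(\<lambda>v. (\<delta> 0 *\<^sub>v v) $ 0) ` carrier_vec (r 1) = {0}" .
  qed (simp_all add: r_def \<delta>_def)
  then show ?thesis unfolding linear_ideal_def by blast
qed

text \<open>The ring is free on one generator of degree 0: the augmentation is the identity and all
  later modules vanish.\<close>

lemma linear_ideal_UNIV: "linear_ideal 0 (UNIV :: ('n::finite, 'k::field) mpoly set)"
proof -
  define r :: "nat \<Rightarrow> nat" where "r = (\<lambda>i. if i \<le> 1 then 1 else 0)"
  define \<delta> :: "nat \<Rightarrow> ('n, 'k) mpoly mat" where "\<delta> = (\<lambda>i. if i = 0 then 1\<^sub>m 1 else 0\<^sub>m (r i) 0)"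
  have car: "\<delta> (Suc i) \<in> carrier_mat (r (Suc i)) 0" for i by (simp add: \<delta>_def)
  have r: "r (Suc (Suc i)) = 0" for i by (simp add: r_def)
  have "linear_res 0 UNIV r \<delta>"
    unfolding linear_res_def
  proof (intro conjI allI impI)
    show "homogeneous (if i = 0 then 0 else 1) (\<delta> i $$ (p, q))" if "p < r i" "q < r (Suc i)" for i p q
      using that by (auto simp: \<delta>_def r_def homogeneous_1 split: if_splits)
    show "mat_kernel (\<delta> i) = (*\<^sub>v) (\<delta> (Suc i)) ` carrier_vec (r (Suc (Suc i)))" for i
    proof (cases i)
      case 0
      then show ?thesis unfolding r mult_mat_vec_image_0[OF car]
        by (auto simp: \<delta>_def r_def mat_kernel_def)
    next
      case (Suc j)
      then show ?thesis unfolding r Suc mat_kernel_0_cols[OF car] mult_mat_vec_image_0[OF car]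
        by (simp add: r_def)
    qed
    have "f \<in> (\<lambda>v. (\<delta> 0 *\<^sub>v v) $ 0) ` carrier_vec (r 1)" for f
      by (rule image_eqI[of _ _ "vec 1 (\<lambda>_. f)"]) (simp_all add: \<delta>_def r_def)
    then show "(\<lambda>v. (\<delta> 0 *\<^sub>v v) $ 0) ` carrier_vec (r 1) = UNIV" by blast
  qed (auto simp: r_def \<delta>_def)
  then show ?thesis unfolding linear_ideal_def by blast
qed

text \<open>Multiplication by a monomial is injective, so scaling the augmentation keeps its kernel.
  The remaining matrices are reused and only the generating degree changes.\<close>

lemma linear_ideal_mono_of_times:
  fixes I :: "('n::finite, 'k::field) mpoly set"
  assumes "linear_ideal d I"
  shows "linear_ideal (int (mdeg s) + d) (mono_of s *o I)"
proof -
  obtain r \<delta> where L: "linear_res d I r \<delta>" using assms by (auto simp: linear_ideal_def)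
  note LD = linear_resD[OF L]
  define \<delta>' where "\<delta>' = (\<lambda>i. if i = 0 then mono_of s \<cdot>\<^sub>m \<delta> 0 else \<delta> i)"
  have mult: "\<delta>' 0 *\<^sub>v v = mono_of s \<cdot>\<^sub>v (\<delta> 0 *\<^sub>v v)" if "v \<in> carrier_vec (r 1)" for v
    using smult_mat_mult_vec[OF LD(2)[of 0]] that by (simp add: \<delta>'_def)
  have car: "\<delta>' i \<in> carrier_mat (r i) (r (Suc i))" for i
    using LD(2) by (simp add: \<delta>'_def)
  have inj: "mono_of s \<cdot>\<^sub>v w = 0\<^sub>v n \<longleftrightarrow> w = 0\<^sub>v n" if "w \<in> carrier_vec n" for w :: "('n, 'k) mpoly vec" and n
  proof
    assume *: "mono_of s \<cdot>\<^sub>v w = 0\<^sub>v n"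
    have "w $ i = 0" if "i < n" for i
    proof -
      have "(mono_of s \<cdot>\<^sub>v w) $ i = 0" using * that by simp
      then have "mono_of s * w $ i = mono_of s * 0" using that \<open>w \<in> carrier_vec n\<close> by simp
      then show ?thesis by (rule mono_of_mult_cancel)
    qed
    then show "w = 0\<^sub>v n" using that by (intro eq_vecI) auto
  qed auto
  have ker: "mat_kernel (\<delta>' 0) = mat_kernel (\<delta> 0)"
    unfolding mat_kernel[OF car] mat_kernel[OF LD(2)]
    using inj[OF mult_mat_vec_carrier[OF LD(2)[of 0]]] by (auto simp: mult)
  have "linear_res (int (mdeg s) + d) (mono_of s *o I) r \<delta>'"
    unfolding linear_res_def
  proof (intro conjI allI impI)
    show "homogeneous (if i = 0 then int (mdeg s) + d else 1) (\<delta>' i $$ (p, q))"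
      if "p < r i" "q < r (Suc i)" for i p q
      using LD(3)[OF that] LD(2)[of i] that
      by (auto simp: \<delta>'_def homogeneous_mono_of intro!: homogeneous_mult)
    show "mat_kernel (\<delta>' i) = (*\<^sub>v) (\<delta>' (Suc i)) ` carrier_vec (r (Suc (Suc i)))" for i
      using LD(4)[of i] ker by (cases "i = 0") (simp_all add: \<delta>'_def)
    have "(\<lambda>v. (\<delta>' 0 *\<^sub>v v) $ 0) ` carrier_vec (r 1) = (\<lambda>v. mono_of s * (\<delta> 0 *\<^sub>v v) $ 0) ` carrier_vec (r 1)"
      using LD(1) LD(2)[of 0] by (intro image_cong) (auto simp: mult)
    also have "\<dots> = mono_of s *o I"
      unfolding LD(5)[symmetric] elt_set_times_def by auto
    finally show "(\<lambda>v. (\<delta>' 0 *\<^sub>v v) $ 0) ` carrier_vec (r 1) = mono_of s *o I" .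
  qed (use LD(1) car in simp_all)
  then show ?thesis unfolding linear_ideal_def by blast
qed

section \<open>Comparison map and mapping cone\<close>

text \<open>The matrices \<open>\<Lambda> i\<close> lift the inclusion \<open>B \<subseteq> A\<close> to the augmented resolutions.\<close>

lemma linear_res_comparison:
  fixes A B :: "('n::finite, 'k::field) mpoly set"
  assumes A: "linear_res d A a \<alpha>" and B: "linear_res (d + 1) B b \<beta>" and sub: "B \<subseteq> A"
  shows "\<exists>\<Lambda>. \<Lambda> 0 = 1\<^sub>m 1 \<and> (\<forall>i. \<Lambda> i \<in> carrier_mat (a i) (b i)) \<and>
    (\<forall>i. \<alpha> i * \<Lambda> (Suc i) = \<Lambda> i * \<beta> i) \<and>
    (\<forall>i. \<forall>p<a i. \<forall>q<b i. homogeneous (if i = 0 then 0 else 1) (\<Lambda> i $$ (p, q)))"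
proof -
  note AD = linear_resD[OF A] and BD = linear_resD[OF B]
  \<comment> \<open>The last clause says that \<open>M\<close> maps the image of
    \<open>\<beta> i\<close> into the image of \<open>\<alpha> i\<close>. It makes the choice of the
    next matrix possible, so it is carried along the recursion.\<close>
  define P where "P i M \<longleftrightarrow> M \<in> carrier_mat (a i) (b i) \<and> (i = 0 \<longrightarrow> M = 1\<^sub>m 1) \<and>
    (\<forall>p<a i. \<forall>q<b i. homogeneous (if i = 0 then 0 else 1) (M $$ (p, q))) \<and>
    (\<forall>v\<in>carrier_vec (b (Suc i)). \<exists>u\<in>carrier_vec (a (Suc i)). M *\<^sub>v (\<beta> i *\<^sub>v v) = \<alpha> i *\<^sub>v u)" for i M
  have "\<exists>\<Lambda>. \<forall>i. P i (\<Lambda> i) \<and> \<alpha> i * \<Lambda> (Suc i) = \<Lambda> i * \<beta> i"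
  proof (rule dependent_nat_choice)
    have "\<exists>u\<in>carrier_vec (a (Suc 0)). 1\<^sub>m 1 *\<^sub>v (\<beta> 0 *\<^sub>v v) = \<alpha> 0 *\<^sub>v u" if v: "v \<in> carrier_vec (b (Suc 0))" for v
    proof -
      have "(\<beta> 0 *\<^sub>v v) $ 0 \<in> A" using linear_res_mem[OF B v] sub by blast
      then obtain u where u: "u \<in> carrier_vec (a (Suc 0))" "(\<alpha> 0 *\<^sub>v u) $ 0 = (\<beta> 0 *\<^sub>v v) $ 0"
        by (rule linear_res_mem_obtains[OF A])
      have car: "\<alpha> 0 *\<^sub>v u \<in> carrier_vec 1" "\<beta> 0 *\<^sub>v v \<in> carrier_vec 1"
        using u v AD(1) AD(2)[of 0] BD(1) BD(2)[of 0] by (metis mult_mat_vec_carrier)+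
      then have "\<beta> 0 *\<^sub>v v = \<alpha> 0 *\<^sub>v u" using u(2) by (intro vec_1_eqI) auto
      with u(1) car show ?thesis by auto
    qed
    then show "\<exists>M. P 0 M"
      using AD(1) BD(1) by (intro exI[of _ "1\<^sub>m 1"]) (auto simp: P_def homogeneous_1)
  next
    fix M i assume PM: "P i M"
    then have M: "M \<in> carrier_mat (a i) (b i)" by (simp add: P_def)
    have N: "M * \<beta> i \<in> carrier_mat (a i) (b (Suc i))" using M BD(2)[of i] by simp
    \<comment> \<open>The generators of \<open>B\<close> have degree one more than those of
      \<open>A\<close>, which forces entries of degree 1 in \<open>\<Lambda> 1\<close>. Afterwards
      all maps involved are linear, and so is each further lift.\<close>
    let ?e = "if i = 0 then d else 1"
    have hN: "homogeneous (?e + 1) ((M * \<beta> i) $$ (p, q))" if pq: "p < a i" "q < b (Suc i)" for p q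
    proof -
      have col: "col (\<beta> i) q \<in> carrier_vec (b i)" using BD(2)[of i] pq by simp
      have "homogeneous ((if i = 0 then 0 else 1) + (if i = 0 then d + 1 else 1)) ((M *\<^sub>v col (\<beta> i) q) $ p)"
        using PM BD(3)[of _ i q] BD(2)[of i] pq
        by (intro homogeneous_mult_mat_vec[OF M col pq(1)]) (auto simp: P_def)
      moreover have "(M * \<beta> i) $$ (p, q) = (M *\<^sub>v col (\<beta> i) q) $ p"
        using M BD(2)[of i] pq by simp
      ultimately show ?thesis by (auto split: if_splits)
    qed
    have sol: "\<exists>u\<in>carrier_vec (a (Suc i)). col (M * \<beta> i) q = \<alpha> i *\<^sub>v u" if q: "q < b (Suc i)" for q
    proof -
      have "col (M * \<beta> i) q = M *\<^sub>v (\<beta> i *\<^sub>v unit_vec (b (Suc i)) q)"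
        using col_mult2[OF M BD(2)[of i] q] mult_unit_vec_eq_col[OF BD(2)[of i] q] by simp
      then show ?thesis using PM unfolding P_def by (metis unit_vec_carrier)
    qed
    obtain M' where M': "M' \<in> carrier_mat (a (Suc i)) (b (Suc i))"
      "\<forall>p<a (Suc i). \<forall>q<b (Suc i). homogeneous 1 (M' $$ (p, q))" "\<alpha> i * M' = M * \<beta> i"
      using homogeneous_factorization[OF AD(2)[of i] N AD(3) hN sol] by blast
    have "\<exists>u\<in>carrier_vec (a (Suc (Suc i))). M' *\<^sub>v (\<beta> (Suc i) *\<^sub>v v) = \<alpha> (Suc i) *\<^sub>v u"
      if v: "v \<in> carrier_vec (b (Suc (Suc i)))" for v
    proof -
      let ?w = "\<beta> (Suc i) *\<^sub>v v"
      have w: "?w \<in> carrier_vec (b (Suc i))" using BD(2)[of "Suc i"] v by (metis mult_mat_vec_carrier)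
      \<comment> \<open>Consecutive maps of \<open>\<beta>\<close> compose to zero, so
        \<open>M'\<close> sends the image of \<open>\<beta> (Suc i)\<close> into the kernel of
        \<open>\<alpha> i\<close>, which is the image of \<open>\<alpha> (Suc i)\<close>.\<close>
      have "\<alpha> i *\<^sub>v (M' *\<^sub>v ?w) = M *\<^sub>v (\<beta> i *\<^sub>v ?w)"
        using assoc_mult_mat_vec[OF AD(2)[of i] M'(1) w] assoc_mult_mat_vec[OF M BD(2)[of i] w] M'(3)
        by simp
      also have "\<dots> = 0\<^sub>v (a i)"
        using exact_mult_eq_zero[OF BD(4) BD(2) v] mult_mat_vec_zero[OF M] by simp
      finally show ?thesis
        using exact_preimage_obtains[OF AD(4) AD(2), of "M' *\<^sub>v ?w" i] w M'(1)
        by (metis mult_mat_vec_carrier)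
    qed
    with M' show "\<exists>M'. P (Suc i) M' \<and> \<alpha> i * M' = M * \<beta> i"
      by (auto simp: P_def)
  qed
  then obtain \<Lambda> where "\<And>i. P i (\<Lambda> i)" "\<And>i. \<alpha> i * \<Lambda> (Suc i) = \<Lambda> i * \<beta> i" by blast
  then show ?thesis by (intro exI[of _ \<Lambda>] conjI allI) (simp_all add: P_def)
qed

text \<open>
  Since \<open>x\<close> is a nonzerodivisor modulo \<open>B\<close>, the sequence
  \<open>0 \<rightarrow> B(-1) \<rightarrow> A(-1) \<oplus> B \<rightarrow> x A + B \<rightarrow> 0\<close> with first map \<open>b \<mapsto> (b, - x b)\<close> is exact, and the
  mapping cone of its lift to the resolutions is again linear.
\<close>

lemma linear_ideal_mult_add:
  fixes A B :: "('n::finite, 'k::field) mpoly set"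
  assumes A: "linear_ideal d A" and B: "linear_ideal (d + 1) B" and sub: "B \<subseteq> A"
    and x: "homogeneous 1 x" and colon: "\<And>f. x * f \<in> B \<Longrightarrow> f \<in> B"
  shows "linear_ideal (d + 1) (x *o A + B)"
proof -
  obtain a \<alpha> where LA: "linear_res d A a \<alpha>" using A by (auto simp: linear_ideal_def)
  obtain b \<beta> where LB: "linear_res (d + 1) B b \<beta>" using B by (auto simp: linear_ideal_def)
  note AD = linear_resD[OF LA] and BD = linear_resD[OF LB]
  have [simp]: "dim_row (\<alpha> 0) = Suc 0" "dim_row (\<beta> 0) = Suc 0"
    using AD(1) AD(2)[of 0] BD(1) BD(2)[of 0] by auto
  obtain \<Lambda> where \<Lambda>0: "\<Lambda> 0 = 1\<^sub>m 1" and \<Lambda>: "\<And>i. \<Lambda> i \<in> carrier_mat (a i) (b i)"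
    and \<Lambda>_comm: "\<And>i. \<alpha> i * \<Lambda> (Suc i) = \<Lambda> i * \<beta> i"
    and \<Lambda>_hom: "\<And>i p q. p < a i \<Longrightarrow> q < b i \<Longrightarrow> homogeneous (if i = 0 then 0 else 1) (\<Lambda> i $$ (p, q))"
    using linear_res_comparison[OF LA LB sub] by blast
  have [simp]: "dim_row (\<Lambda> i) = a i" for i using \<Lambda> by auto
  \<comment> \<open>\<open>\<mu>\<close> is the direct sum of the two augmented complexes, and
    \<open>\<psi>\<close> is the chain map into it that lifts \<open>b \<mapsto> (b, - x b)\<close>.
    At index 0 it is the column \<open>(1, - x)\<close>.\<close>
  define \<mu> where "\<mu> i = four_block_mat (\<alpha> i) (0\<^sub>m (a i) (b (Suc i))) (0\<^sub>m (b i) (a (Suc i))) (\<beta> i)" for i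
  define \<psi> where "\<psi> i = \<Lambda> i @\<^sub>r ((- x) \<cdot>\<^sub>m 1\<^sub>m (b i))" for i
  have \<mu>: "\<mu> i \<in> carrier_mat (a i + b i) (a (Suc i) + b (Suc i))" for i
    unfolding \<mu>_def using AD(2) BD(2) by (rule four_block_carrier_mat)
  have \<psi>: "\<psi> i \<in> carrier_mat (a i + b i) (b i)" for i
    unfolding \<psi>_def using \<Lambda> by (intro carrier_append_rows) auto
  have \<mu>_exact: "mat_kernel (\<mu> i) = (*\<^sub>v) (\<mu> (Suc i)) ` carrier_vec (a (Suc (Suc i)) + b (Suc (Suc i)))" for i
    unfolding \<mu>_def by (rule block_diag_exact[OF AD(2) AD(2) BD(2) BD(2) AD(4) BD(4)])
  have \<mu>v: "\<mu> i *\<^sub>v (u @\<^sub>v v) = (\<alpha> i *\<^sub>v u) @\<^sub>v (\<beta> i *\<^sub>v v)"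
    if "u \<in> carrier_vec (a (Suc i))" "v \<in> carrier_vec (b (Suc i))" for i u v
    unfolding \<mu>_def
    using four_block_mat_mult_vec[OF AD(2) zero_carrier_mat zero_carrier_mat BD(2) that]
      right_zero_vec[OF mult_mat_vec_carrier[OF AD(2) that(1)]]
      left_zero_vec[OF mult_mat_vec_carrier[OF BD(2) that(2)]]
    by (simp add: zero_mat_mult_vec that)
  have \<psi>v: "\<psi> i *\<^sub>v w = (\<Lambda> i *\<^sub>v w) @\<^sub>v ((- x) \<cdot>\<^sub>v w)" if "w \<in> carrier_vec (b i)" for i w
    unfolding \<psi>_def
    using mat_mult_append[OF \<Lambda>[of i] smult_carrier_mat[OF one_carrier_mat] that, of "- x"]
      smult_mat_mult_vec[OF one_carrier_mat that, of "- x"] that by simp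
  have comm: "\<mu> i *\<^sub>v (\<psi> (Suc i) *\<^sub>v w) = \<psi> i *\<^sub>v (\<beta> i *\<^sub>v w)" if w: "w \<in> carrier_vec (b (Suc i))" for i w
  proof -
    have "\<mu> i *\<^sub>v (\<psi> (Suc i) *\<^sub>v w) = (\<alpha> i *\<^sub>v (\<Lambda> (Suc i) *\<^sub>v w)) @\<^sub>v (\<beta> i *\<^sub>v ((- x) \<cdot>\<^sub>v w))"
      unfolding \<psi>v[OF w] by (rule \<mu>v[OF mult_mat_vec_carrier[OF \<Lambda> w] smult_carrier_vec[THEN iffD2, OF w]])
    also have "\<alpha> i *\<^sub>v (\<Lambda> (Suc i) *\<^sub>v w) = \<Lambda> i *\<^sub>v (\<beta> i *\<^sub>v w)"
      using assoc_mult_mat_vec[OF AD(2) \<Lambda> w] assoc_mult_mat_vec[OF \<Lambda> BD(2) w] \<Lambda>_comm by simp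
    also have "\<beta> i *\<^sub>v ((- x) \<cdot>\<^sub>v w) = (- x) \<cdot>\<^sub>v (\<beta> i *\<^sub>v w)"
      by (rule mult_mat_vec_smult[OF BD(2) w])
    finally show ?thesis unfolding \<psi>v[OF mult_mat_vec_carrier[OF BD(2) w]] .
  qed
  \<comment> \<open>The cone is formed with the resolution of \<open>B\<close> without its
    augmentation row; hence \<open>\<kappa> 0\<close> has no rows.\<close>
  define k where "k i = (if i = 0 then 0 else b i)" for i :: nat
  define \<kappa> where "\<kappa> i = (if i = 0 then 0\<^sub>m 0 (b 1) else \<beta> i)" for i :: nat
  have \<kappa>: "\<kappa> i \<in> carrier_mat (k i) (b (Suc i))" for i using BD(2)[of i] by (simp add: \<kappa>_def k_def)
  have \<kappa>\<beta>: "\<kappa> i *\<^sub>v (\<beta> (Suc i) *\<^sub>v w) = 0\<^sub>v (k i)" if "w \<in> carrier_vec (b (Suc (Suc i)))" for i w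
    using exact_mult_eq_zero[OF BD(4) BD(2) that] mult_mat_vec_carrier[OF BD(2) that]
    by (auto simp: \<kappa>_def k_def zero_mat_mult_vec)
  \<comment> \<open>The shifted copy of the modules of \<open>B\<close> enters one place later than
    the direct sum. Since \<open>k 0 = 0\<close>, the first free module has just the generators of
    \<open>A\<close> and \<open>B\<close>.\<close>
  define r where "r i = (case i of 0 \<Rightarrow> 1 | Suc j \<Rightarrow> (a i + b i) + k j)" for i :: nat
  define D where "D i = four_block_mat (\<mu> (Suc i)) (\<psi> (Suc i))
    (0\<^sub>m (k i) (a (Suc (Suc i)) + b (Suc (Suc i)))) (- \<kappa> i)" for i
  \<comment> \<open>The augmentation onto \<open>x A + B\<close> is the row with parts
    \<open>x \<alpha> 0\<close> and \<open>\<beta> 0\<close>, written as a block matrix whose lower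
    blocks have no rows.\<close>
  define \<gamma> where "\<gamma> = four_block_mat (x \<cdot>\<^sub>m \<alpha> 0) (\<beta> 0) (0\<^sub>m 0 (a 1)) (0\<^sub>m 0 (b 1))"
  define \<delta> where "\<delta> i = (case i of 0 \<Rightarrow> \<gamma> | Suc j \<Rightarrow> D j)" for i :: nat
  have r: "r 0 = 1" "r (Suc 0) = a (Suc 0) + b (Suc 0)" "r (Suc i) = (a (Suc i) + b (Suc i)) + k i"
    "r (Suc (Suc i)) = (a (Suc (Suc i)) + b (Suc (Suc i))) + b (Suc i)" for i
    by (simp_all add: r_def k_def)
  have D: "D i \<in> carrier_mat (r (Suc i)) (r (Suc (Suc i)))" for i
    unfolding D_def r(3)[of i] r(4) by (rule four_block_carrier_mat[OF \<mu> uminus_carrier_mat[OF \<kappa>]])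
  have x\<alpha>: "x \<cdot>\<^sub>m \<alpha> 0 \<in> carrier_mat 1 (a 1)" and \<beta>0: "\<beta> 0 \<in> carrier_mat 1 (b 1)"
    using AD(2)[of 0] AD(1) BD(2)[of 0] BD(1) by simp_all
  have \<gamma>: "\<gamma> \<in> carrier_mat 1 (a (Suc 0) + b (Suc 0))"
    using four_block_carrier_mat[OF x\<alpha>, of "0\<^sub>m 0 (b 1)" 0 "b 1"] by (simp add: \<gamma>_def)
  have \<gamma>v: "(\<gamma> *\<^sub>v (u @\<^sub>v v)) $ 0 = x * (\<alpha> 0 *\<^sub>v u) $ 0 + (\<beta> 0 *\<^sub>v v) $ 0"
    if uv: "u \<in> carrier_vec (a (Suc 0))" "v \<in> carrier_vec (b (Suc 0))" for u v
  proof -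
    have car: "\<alpha> 0 *\<^sub>v u \<in> carrier_vec 1" "\<beta> 0 *\<^sub>v v \<in> carrier_vec 1"
      using mult_mat_vec_carrier[OF AD(2) uv(1)] mult_mat_vec_carrier[OF BD(2) uv(2)] AD(1) BD(1)
      by simp_all
    have "\<gamma> *\<^sub>v (u @\<^sub>v v) = ((x \<cdot>\<^sub>m \<alpha> 0) *\<^sub>v u + \<beta> 0 *\<^sub>v v) @\<^sub>v (0\<^sub>m 0 (a 1) *\<^sub>v u + 0\<^sub>m 0 (b 1) *\<^sub>v v)"
      unfolding \<gamma>_def using uv
      by (intro four_block_mat_mult_vec[OF x\<alpha> \<beta>0 zero_carrier_mat zero_carrier_mat]) simp_all
    also have "(x \<cdot>\<^sub>m \<alpha> 0) *\<^sub>v u = x \<cdot>\<^sub>v (\<alpha> 0 *\<^sub>v u)" by (rule smult_mat_mult_vec[OF AD(2) uv(1)])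
    finally show ?thesis using car by (simp del: index_mult_mat_vec)
  qed
  have \<gamma>_exact: "mat_kernel \<gamma> = (*\<^sub>v) (D 0) ` carrier_vec (r (Suc (Suc 0)))"
  proof -
    have k0: "k 0 = 0" by (simp add: k_def)
    have D0v: "D 0 *\<^sub>v (m @\<^sub>v w) = \<mu> (Suc 0) *\<^sub>v m + \<psi> (Suc 0) *\<^sub>v w"
      if m: "m \<in> carrier_vec (a (Suc (Suc 0)) + b (Suc (Suc 0)))" and w: "w \<in> carrier_vec (b (Suc 0))" for m w
    proof -
      have "D 0 *\<^sub>v (m @\<^sub>v w) = (\<mu> (Suc 0) *\<^sub>v m + \<psi> (Suc 0) *\<^sub>v w) @\<^sub>v
        (0\<^sub>m (k 0) (a (Suc (Suc 0)) + b (Suc (Suc 0))) *\<^sub>v m + (- \<kappa> 0) *\<^sub>v w)"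
        unfolding D_def by (rule four_block_mat_mult_vec[OF \<mu> \<psi> zero_carrier_mat uminus_carrier_mat[OF \<kappa>] m w])
      then show ?thesis by (intro eq_vecI) (auto simp: k0 \<kappa>_def simp del: index_mult_mat_vec)
    qed
    have ker: "v \<in> mat_kernel \<gamma> \<longleftrightarrow> v \<in> carrier_vec (a (Suc 0) + b (Suc 0)) \<and> (\<gamma> *\<^sub>v v) $ 0 = 0" for v
    proof -
      have "w $ 0 = 0 \<longleftrightarrow> w = 0\<^sub>v 1" if "w \<in> carrier_vec 1" for w :: "('n, 'k) mpoly vec"
        using vec_1_eqI[of w "0\<^sub>v 1"] that by auto
      from this[OF mult_mat_vec_carrier[OF \<gamma>]] show ?thesis unfolding mat_kernel[OF \<gamma>] by blast
    qed
    have \<Lambda>1: "(\<alpha> 0 *\<^sub>v (\<Lambda> (Suc 0) *\<^sub>v w)) $ 0 = (\<beta> 0 *\<^sub>v w) $ 0" if w: "w \<in> carrier_vec (b (Suc 0))" for w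
      using assoc_mult_mat_vec[OF AD(2) \<Lambda> w] assoc_mult_mat_vec[OF \<Lambda> BD(2) w] \<Lambda>_comm[of 0]
        mult_mat_vec_carrier[OF BD(2) w] BD(1) by (simp add: \<Lambda>0)
    show ?thesis
    proof (intro equalityI subsetI)
      fix z assume "z \<in> mat_kernel \<gamma>"
      then obtain u v where z: "z = u @\<^sub>v v" and u: "u \<in> carrier_vec (a (Suc 0))"
        and v: "v \<in> carrier_vec (b (Suc 0))" and zero: "x * (\<alpha> 0 *\<^sub>v u) $ 0 + (\<beta> 0 *\<^sub>v v) $ 0 = 0"
        unfolding ker by (metis carrier_vec_append_obtains \<gamma>v)
      \<comment> \<open>The relation puts \<open>x \<alpha> 0 u\<close> into \<open>B\<close>, and
        the colon hypothesis then gives \<open>\<alpha> 0 u = \<beta> 0 w\<close> for some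
        \<open>w\<close>. Subtracting \<open>\<psi> 1 w\<close> from \<open>(u, v)\<close> leaves
        \<open>u - \<Lambda> 1 w\<close> and \<open>v + x w\<close>, which lie in the kernels of
        \<open>\<alpha> 0\<close> and \<open>\<beta> 0\<close>.\<close>
      have "x * (\<alpha> 0 *\<^sub>v u) $ 0 = (\<beta> 0 *\<^sub>v (- v)) $ 0"
        using zero mult_mat_vec_uminus[OF BD(2) v] mult_mat_vec_carrier[OF BD(2) v] BD(1)
        by (simp add: eq_neg_iff_add_eq_0 del: index_mult_mat_vec)
      then have "x * (\<alpha> 0 *\<^sub>v u) $ 0 \<in> B" using linear_res_mem[OF LB, of "- v"] v by simp
      then have "(\<alpha> 0 *\<^sub>v u) $ 0 \<in> B" by (rule colon)
      then obtain w where w: "w \<in> carrier_vec (b (Suc 0))" "(\<beta> 0 *\<^sub>v w) $ 0 = (\<alpha> 0 *\<^sub>v u) $ 0"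
        by (rule linear_res_mem_obtains[OF LB])
      have \<Lambda>w: "\<Lambda> (Suc 0) *\<^sub>v w \<in> carrier_vec (a (Suc 0))" by (rule mult_mat_vec_carrier[OF \<Lambda> w(1)])
      have "\<alpha> 0 *\<^sub>v (u - \<Lambda> (Suc 0) *\<^sub>v w) = 0\<^sub>v (a 0)"
      proof -
        have "\<alpha> 0 *\<^sub>v u = \<alpha> 0 *\<^sub>v (\<Lambda> (Suc 0) *\<^sub>v w)"
          using mult_mat_vec_carrier[OF AD(2) u] mult_mat_vec_carrier[OF AD(2) \<Lambda>w] w \<Lambda>1[OF w(1)] AD(1)
          by (intro vec_1_eqI) simp_all
        then show ?thesis
          using mult_minus_distrib_mat_vec[OF AD(2) u \<Lambda>w] mult_mat_vec_carrier[OF AD(2) \<Lambda>w] by simp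
      qed
      then obtain u' where u': "u' \<in> carrier_vec (a (Suc (Suc 0)))" "u - \<Lambda> (Suc 0) *\<^sub>v w = \<alpha> (Suc 0) *\<^sub>v u'"
        using exact_preimage_obtains[OF AD(4) AD(2)] u \<Lambda>w by (metis minus_carrier_vec)
      have "\<beta> 0 *\<^sub>v (v + x \<cdot>\<^sub>v w) = 0\<^sub>v (b 0)"
      proof -
        have "(\<beta> 0 *\<^sub>v v + x \<cdot>\<^sub>v (\<beta> 0 *\<^sub>v w)) $ 0 = 0"
          using zero w(2) mult_mat_vec_carrier[OF BD(2) v] mult_mat_vec_carrier[OF BD(2) w(1)] BD(1)
          by (simp add: add.commute del: index_mult_mat_vec)
        then have "\<beta> 0 *\<^sub>v v + x \<cdot>\<^sub>v (\<beta> 0 *\<^sub>v w) = 0\<^sub>v 1"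
          using mult_mat_vec_carrier[OF BD(2) v] mult_mat_vec_carrier[OF BD(2) w(1)] BD(1)
          by (intro vec_1_eqI) simp_all
        then show ?thesis
          using mult_add_distrib_mat_vec[OF BD(2) v, of "x \<cdot>\<^sub>v w"] mult_mat_vec_smult[OF BD(2) w(1)] w(1) BD(1)
          by simp
      qed
      then obtain v' where v': "v' \<in> carrier_vec (b (Suc (Suc 0)))" "v + x \<cdot>\<^sub>v w = \<beta> (Suc 0) *\<^sub>v v'"
        using exact_preimage_obtains[OF BD(4) BD(2)] v w(1) by (metis add_carrier_vec smult_carrier_vec)
      have u_eq: "u = \<alpha> (Suc 0) *\<^sub>v u' + \<Lambda> (Suc 0) *\<^sub>v w"
        unfolding u'(2)[symmetric] using u \<Lambda>w by (intro eq_vecI) (simp_all del: index_mult_mat_vec)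
      have v_eq: "v = \<beta> (Suc 0) *\<^sub>v v' + (- x) \<cdot>\<^sub>v w"
        unfolding v'(2)[symmetric] using v w by (intro eq_vecI) simp_all
      have "z = \<mu> (Suc 0) *\<^sub>v (u' @\<^sub>v v') + \<psi> (Suc 0) *\<^sub>v w"
        unfolding z \<mu>v[OF u'(1) v'(1)] \<psi>v[OF w(1)]
        using append_vec_add[OF mult_mat_vec_carrier[OF AD(2) u'(1)] \<Lambda>w
            mult_mat_vec_carrier[OF BD(2) v'(1)] smult_carrier_vec[THEN iffD2, OF w(1)], of "- x"]
        by (simp flip: u_eq v_eq)
      then have "z = D 0 *\<^sub>v ((u' @\<^sub>v v') @\<^sub>v w)"
        using D0v u' v' w by simp
      then show "z \<in> (*\<^sub>v) (D 0) ` carrier_vec (r (Suc (Suc 0)))"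
        unfolding r(4) using u' v' w by blast
    next
      fix z assume "z \<in> (*\<^sub>v) (D 0) ` carrier_vec (r (Suc (Suc 0)))"
      then obtain m w where zm: "z = D 0 *\<^sub>v (m @\<^sub>v w)" and m: "m \<in> carrier_vec (a (Suc (Suc 0)) + b (Suc (Suc 0)))"
        and w: "w \<in> carrier_vec (b (Suc 0))"
        unfolding r(4) by (auto elim!: carrier_vec_append_obtains)
      from m obtain u v where m_eq: "m = u @\<^sub>v v" and u: "u \<in> carrier_vec (a (Suc (Suc 0)))"
        and v: "v \<in> carrier_vec (b (Suc (Suc 0)))"
        by (rule carrier_vec_append_obtains)
      let ?u = "\<alpha> (Suc 0) *\<^sub>v u" and ?u' = "\<Lambda> (Suc 0) *\<^sub>v w" and ?v = "\<beta> (Suc 0) *\<^sub>v v" and ?v' = "(- x) \<cdot>\<^sub>v w"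
      have car: "?u \<in> carrier_vec (a (Suc 0))" "?u' \<in> carrier_vec (a (Suc 0))"
        "?v \<in> carrier_vec (b (Suc 0))" "?v' \<in> carrier_vec (b (Suc 0))"
        using mult_mat_vec_carrier[OF AD(2) u] mult_mat_vec_carrier[OF \<Lambda> w]
          mult_mat_vec_carrier[OF BD(2) v] w by simp_all
      have z: "z = (?u + ?u') @\<^sub>v (?v + ?v')"
        using zm D0v[OF m w] append_vec_add[OF car] by (simp only: m_eq \<mu>v[OF u v] \<psi>v[OF w])
      \<comment> \<open>The parts coming from \<open>\<mu>\<close> are killed by exactness; those
        coming from \<open>\<psi> 1 w\<close> contribute \<open>x \<beta> 0 w\<close> and its
        negative to the augmentation.\<close>
      have "\<alpha> 0 *\<^sub>v (?u + ?u') = \<alpha> 0 *\<^sub>v ?u'"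
        unfolding mult_add_distrib_mat_vec[OF AD(2) car(1,2)] exact_mult_eq_zero[OF AD(4) AD(2) u]
        by (rule left_zero_vec[OF mult_mat_vec_carrier[OF AD(2) car(2)]])
      moreover have "\<beta> 0 *\<^sub>v (?v + ?v') = (- x) \<cdot>\<^sub>v (\<beta> 0 *\<^sub>v w)"
        unfolding mult_add_distrib_mat_vec[OF BD(2) car(3,4)] exact_mult_eq_zero[OF BD(4) BD(2) v]
          mult_mat_vec_smult[OF BD(2) w]
        by (rule left_zero_vec) (rule smult_carrier_vec[THEN iffD2, OF mult_mat_vec_carrier[OF BD(2) w]])
      ultimately have "(\<gamma> *\<^sub>v z) $ 0 = 0"
        unfolding z using \<gamma>v[of "?u + ?u'" "?v + ?v'"] car \<Lambda>1[OF w] mult_mat_vec_carrier[OF BD(2) w] BD(1)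
        by (simp del: index_mult_mat_vec)
      then show "z \<in> mat_kernel \<gamma>" unfolding ker using car z by auto
    qed
  qed
  have D_exact: "mat_kernel (D i) = (*\<^sub>v) (D (Suc i)) ` carrier_vec (r (Suc (Suc (Suc i))))" for i
  proof -
    have kS: "k (Suc i) = b (Suc i)" and \<kappa>S: "\<kappa> (Suc i) = \<beta> (Suc i)" by (simp_all add: k_def \<kappa>_def)
    have lift: "\<exists>w'\<in>carrier_vec (b (Suc (Suc i))). w = \<beta> (Suc i) *\<^sub>v w'"
      if u: "u \<in> carrier_vec (a (Suc (Suc i)) + b (Suc (Suc i)))" and w: "w \<in> carrier_vec (b (Suc i))"
        and 1: "\<mu> (Suc i) *\<^sub>v u + \<psi> (Suc i) *\<^sub>v w = 0\<^sub>v (a (Suc i) + b (Suc i))"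
        and 2: "\<kappa> i *\<^sub>v w = 0\<^sub>v (k i)" for u w
    proof -
      have "\<beta> i *\<^sub>v w = 0\<^sub>v (b i)"
      proof (cases "i = 0")
        case False
        then show ?thesis using 2 by (simp add: \<kappa>_def k_def)
      next
        \<comment> \<open>\<open>\<kappa> 0\<close> imposes no condition, so
          \<open>\<beta> 0 w = 0\<close> is extracted from \<open>1\<close>: applying
          \<open>\<mu> 0\<close> leaves \<open>\<psi> 0 (\<beta> 0 w) = 0\<close>, whose first block
          is \<open>\<beta> 0 w\<close> because \<open>\<Lambda> 0\<close> is the identity.\<close>
        case True
        have \<mu>u: "\<mu> (Suc i) *\<^sub>v u \<in> carrier_vec (a (Suc i) + b (Suc i))"
          and \<psi>w: "\<psi> (Suc i) *\<^sub>v w \<in> carrier_vec (a (Suc i) + b (Suc i))"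
          using mult_mat_vec_carrier[OF \<mu> u] mult_mat_vec_carrier[OF \<psi> w] by simp_all
        have \<beta>w: "\<beta> i *\<^sub>v w \<in> carrier_vec (b i)" by (rule mult_mat_vec_carrier[OF BD(2) w])
        have "\<mu> i *\<^sub>v (\<mu> (Suc i) *\<^sub>v u + \<psi> (Suc i) *\<^sub>v w) = \<psi> i *\<^sub>v (\<beta> i *\<^sub>v w)"
          unfolding mult_add_distrib_mat_vec[OF \<mu> \<mu>u \<psi>w] exact_mult_eq_zero[OF \<mu>_exact \<mu> u] comm[OF w]
          by (rule left_zero_vec[OF mult_mat_vec_carrier[OF \<psi> \<beta>w]])
        then have "\<psi> i *\<^sub>v (\<beta> i *\<^sub>v w) = 0\<^sub>v (a i) @\<^sub>v 0\<^sub>v (b i)"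
          unfolding 1 mult_mat_vec_zero[OF \<mu>] by (simp only: zero_vec_append)
        then have "\<Lambda> i *\<^sub>v (\<beta> i *\<^sub>v w) = 0\<^sub>v (a i)"
          unfolding \<psi>v[OF \<beta>w]
          using append_vec_eq[OF mult_mat_vec_carrier[OF \<Lambda>[of i] \<beta>w] zero_carrier_vec] by blast
        then show ?thesis using True \<beta>w AD(1) BD(1) by (simp add: \<Lambda>0)
      qed
      then show ?thesis using exact_preimage_obtains[OF BD(4) BD(2) w] by metis
    qed
    show ?thesis
      unfolding D_def r(4) kS \<kappa>S
      by (rule mapping_cone_exact[OF \<mu> \<mu> \<psi> \<psi> \<kappa> BD(2) \<mu>_exact comm \<kappa>\<beta> lift])
  qed
  have "linear_res (d + 1) (x *o A + B) r \<delta>"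
    unfolding linear_res_def
  proof (intro conjI allI impI)
    show "r 0 = 1" by (rule r(1))
    show "\<delta> i \<in> carrier_mat (r i) (r (Suc i))" for i
      using \<gamma> D by (cases i) (simp_all add: \<delta>_def r(1,2))
    show "mat_kernel (\<delta> i) = (*\<^sub>v) (\<delta> (Suc i)) ` carrier_vec (r (Suc (Suc i)))" for i
      using \<gamma>_exact D_exact by (cases i) (simp_all add: \<delta>_def)
    show "homogeneous (if i = 0 then d + 1 else 1) (\<delta> i $$ (p, q))" if pq: "p < r i" "q < r (Suc i)" for i p q
    proof (cases i)
      case 0
      \<comment> \<open>Both blocks of the augmentation have degree \<open>d + 1\<close>: on the
        left the factor \<open>x\<close> makes up for the lower degree of the generators of
        \<open>A\<close>.\<close>
      have x\<alpha>_hom: "homogeneous (d + 1) ((x \<cdot>\<^sub>m \<alpha> 0) $$ (p, q))" if "p < 1" "q < a 1" for p q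
      proof -
        have "homogeneous (1 + d) (x * \<alpha> 0 $$ (p, q))"
          using AD(3)[of p 0 q] that AD(1) x by (intro homogeneous_mult) simp_all
        then show ?thesis using AD(2)[of 0] AD(1) that by (simp add: add.commute)
      qed
      have \<beta>_hom: "homogeneous (d + 1) (\<beta> 0 $$ (p, q))" if "p < 1" "q < b 1" for p q
        using BD(3)[of p 0 q] that BD(1) by simp
      have "homogeneous (d + 1) (\<gamma> $$ (p, q))"
        unfolding \<gamma>_def
        by (rule homogeneous_four_block_mat[OF x\<alpha> \<beta>0 _ _ x\<alpha>_hom \<beta>_hom, where ?n2.0 = 0])
           (use pq 0 r(1,2) in simp_all)
      then show ?thesis by (simp add: 0 \<delta>_def)
    next
      case (Suc j)
      have \<mu>_hom: "homogeneous 1 (\<mu> (Suc j) $$ (p, q))"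
        if "p < a (Suc j) + b (Suc j)" "q < a (Suc (Suc j)) + b (Suc (Suc j))" for p q
        unfolding \<mu>_def
        by (rule homogeneous_four_block_mat[OF AD(2) zero_carrier_mat zero_carrier_mat BD(2) _ _ _ _ that])
           (use AD(3)[of _ "Suc j"] BD(3)[of _ "Suc j"] in simp_all)
      have \<psi>_hom: "homogeneous 1 (\<psi> (Suc j) $$ (p, q))"
        if "p < a (Suc j) + b (Suc j)" "q < b (Suc j)" for p q
      proof -
        \<comment> \<open>Stacking rows unfolds to a block matrix whose right blocks have no
          columns.\<close>
        have "homogeneous 1 (four_block_mat (\<Lambda> (Suc j)) (0\<^sub>m (a (Suc j)) 0)
          ((- x) \<cdot>\<^sub>m 1\<^sub>m (b (Suc j))) (0\<^sub>m (b (Suc j)) 0) $$ (p, q))"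
          by (rule homogeneous_four_block_mat[OF \<Lambda> zero_carrier_mat smult_carrier_mat[OF one_carrier_mat]
                zero_carrier_mat])
             (use \<Lambda>_hom[of _ "Suc j"] x that in \<open>simp_all add: homogeneous_uminus\<close>)
        then show ?thesis using \<Lambda>[of "Suc j"] by (simp add: \<psi>_def append_rows_def)
      qed
      have \<kappa>_hom: "homogeneous 1 ((- \<kappa> j) $$ (p, q))" if "p < k j" "q < b (Suc j)" for p q
        using that BD(3)[of p j q] BD(2)[of j]
        by (auto simp: k_def \<kappa>_def homogeneous_uminus split: if_splits)
      have "homogeneous 1 (D j $$ (p, q))"
        unfolding D_def
        by (rule homogeneous_four_block_mat[OF \<mu> \<psi> zero_carrier_mat uminus_carrier_mat[OF \<kappa>] \<mu>_hom \<psi>_hom _ \<kappa>_hom])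
           (use pq Suc r(3)[of j] r(4)[of j] in simp_all)
      then show ?thesis by (simp add: Suc \<delta>_def)
    qed
    show "(\<lambda>v. (\<delta> 0 *\<^sub>v v) $ 0) ` carrier_vec (r 1) = x *o A + B"
    proof (intro equalityI subsetI)
      fix f assume "f \<in> (\<lambda>v. (\<delta> 0 *\<^sub>v v) $ 0) ` carrier_vec (r 1)"
      then obtain u v where uv: "u \<in> carrier_vec (a (Suc 0))" "v \<in> carrier_vec (b (Suc 0))"
        and f: "f = (\<gamma> *\<^sub>v (u @\<^sub>v v)) $ 0"
        by (auto simp: \<delta>_def r(2) elim!: carrier_vec_append_obtains simp del: index_mult_mat_vec)
      show "f \<in> x *o A + B"
        unfolding f \<gamma>v[OF uv]
        by (intro set_plus_intro set_times_intro2 linear_res_mem[OF LA uv(1)] linear_res_mem[OF LB uv(2)])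
    next
      fix f assume "f \<in> x *o A + B"
      then obtain g h where gh: "g \<in> A" "h \<in> B" and f: "f = x * g + h"
        unfolding elt_set_times_def set_plus_def by blast
      obtain u v where "u \<in> carrier_vec (a (Suc 0))" "(\<alpha> 0 *\<^sub>v u) $ 0 = g"
        "v \<in> carrier_vec (b (Suc 0))" "(\<beta> 0 *\<^sub>v v) $ 0 = h"
        using linear_res_mem_obtains[OF LA gh(1)] linear_res_mem_obtains[OF LB gh(2)] by metis
      then show "f \<in> (\<lambda>v. (\<delta> 0 *\<^sub>v v) $ 0) ` carrier_vec (r 1)"
        by (intro image_eqI[of _ _ "u @\<^sub>v v"])
           (simp_all add: f \<delta>_def \<gamma>v r(2) del: index_mult_mat_vec)
    qed
  qed
  then show ?thesis unfolding linear_ideal_def by blast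
qed


subsection \<open>Monomials of fixed degree in a set of variables\<close>

definition level :: "('n::finite, 'k::field) mpoly set \<Rightarrow> 'n set \<Rightarrow> nat \<Rightarrow> ('n \<Rightarrow>\<^sub>0 nat) set"
  where "level I V d = {t. mono_of t \<in> I \<and> Poly_Mapping.keys t \<subseteq> V \<and> mdeg t = d}"

text \<open>Only the generators are confined to \<open>V\<close>; the ideal is taken in the full
  ring, so that levels for different \<open>V\<close> can be compared and added.\<close>

abbreviation level_ideal :: "('n::finite, 'k::field) mpoly set \<Rightarrow> 'n set \<Rightarrow> nat \<Rightarrow> ('n, 'k) mpoly set"
  where "level_ideal I V d \<equiv> ideal_of (mono_of ` level I V d)"

text \<open>A homogeneous element of a monomial ideal is a combination of monomials of the same
  degree in the ideal, so these generate the component.\<close>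

lemma degree_component_ideal_eq_level:
  fixes I :: "('n::finite, 'k::field) mpoly set"
  assumes "monomial_ideal I"
  shows "degree_component_ideal I d = level_ideal I UNIV d"
proof
  show "level_ideal I UNIV d \<subseteq> degree_component_ideal I d"
    unfolding degree_component_ideal_def
    by (intro idl.span_mono) (auto simp: level_def homogeneous_def)
  have "f \<in> level_ideal I UNIV d" if "f \<in> I" "homogeneous (int d) f" for f
  proof (rule mem_ideal_if_keys)
    fix t assume t: "t \<in> Poly_Mapping.keys f"
    then have "mono_of t \<in> I" using that(1) mem_monomial_ideal_iff[OF assms] by blast
    then have "t \<in> level I UNIV d" using t that(2) by (simp add: level_def homogeneous_def)
    then show "mono_of t \<in> level_ideal I UNIV d" by (intro idl.span_base imageI)
  qed
  then show "degree_component_ideal I d \<subseteq> level_ideal I UNIV d"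
    unfolding degree_component_ideal_def by (intro idl.span_minimal) auto
qed

lemma ideal_of_empty: "ideal_of {} = {0 :: 'a::comm_ring_1}"
  by (rule idl.span_empty)

lemma ideal_of_Un: "ideal_of (A \<union> B) = ideal_of A + ideal_of B"
  unfolding idl.span_Un set_plus_def by blast

lemma ideal_of_1: "ideal_of {1} = (UNIV :: 'a::comm_ring_1 set)"
proof -
  have "f * 1 \<in> ideal_of {1}" for f :: 'a by (intro idl.span_scale idl.span_base) simp
  then show ?thesis by auto
qed

lemma mono_of_0: "mono_of 0 = 1"
  by (simp add: mono_of_def)

lemma linear_level_empty: "level I V d = {} \<Longrightarrow> linear_ideal (int d) (level_ideal I V d)"
  by (simp add: ideal_of_empty linear_ideal_0)

lemma ideal_of_mono_of_add_image:
  "ideal_of (mono_of ` (+) s ` T) = (mono_of s :: ('n, 'k::field) mpoly) *o ideal_of (mono_of ` T)"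
  by (simp add: image_image mono_of_mult flip: ideal_of_times_image)

lemma level_split:
  fixes I :: "('n::finite, 'k::field) mpoly set"
  assumes "x \<in> V" "\<And>u. mono_of (Poly_Mapping.single x 1 + u) \<in> I"
  shows "level I V (Suc d) =
    (+) (Poly_Mapping.single x 1) ` level (UNIV :: ('n, 'k) mpoly set) V d \<union> level I (V - {x}) (Suc d)"
    (is "_ = ?R")
proof (intro equalityI subsetI)
  fix t assume t: "t \<in> level I V (Suc d)"
  show "t \<in> ?R"
  \<comment> \<open>Sort by divisibility by \<open>x\<close>. As all multiples of \<open>x\<close>
    lie in \<open>I\<close>, the cofactor of \<open>x\<close> may be any monomial of degree
    \<open>d\<close> in the variables of \<open>V\<close>.\<close>
  proof (cases "x \<in> Poly_Mapping.keys t")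
    case True
    then obtain u where u: "t = Poly_Mapping.single x 1 + u" by (metis lookup_pos_obtains in_keys_iff gr0I)
    then have "u \<in> level (UNIV :: ('n, 'k) mpoly set) V d" using t by (simp add: level_def mdeg_add mdeg_single keys_add_nat)
    with u show ?thesis by blast
  next
    case False
    then show ?thesis using t by (auto simp: level_def)
  qed
next
  fix t assume "t \<in> ?R"
  then show "t \<in> level I V (Suc d)"
    using assms by (auto simp: level_def mdeg_add mdeg_single keys_add_nat)
qed

lemma linear_level_step:
  fixes I :: "('n::finite, 'k::field) mpoly set"
  assumes x: "x \<in> V" "\<And>u. mono_of (Poly_Mapping.single x 1 + u) \<in> I"
    and "linear_ideal (int d) (level_ideal (UNIV :: ('n, 'k) mpoly set) V d)"
    and "linear_ideal (int (Suc d)) (level_ideal I (V - {x}) (Suc d))"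
  shows "linear_ideal (int (Suc d)) (level_ideal I V (Suc d))"
proof -
  let ?A = "level_ideal (UNIV :: ('n, 'k) mpoly set) V d" and ?B = "level_ideal I (V - {x}) (Suc d)"
  have "level_ideal I V (Suc d) = Var x *o ?A + ?B"
    unfolding level_split[OF x] image_Un ideal_of_Un ideal_of_mono_of_add_image Var_def ..
  \<comment> \<open>Cancelling any one variable from a generator of \<open>?B\<close> leaves a
    monomial of degree \<open>d\<close> in the variables of \<open>V\<close>, a generator of
    \<open>?A\<close>.\<close>
  moreover have "?B \<subseteq> ?A"
  proof (rule idl.span_minimal)
    show "mono_of ` level I (V - {x}) (Suc d) \<subseteq> ?A"
    proof
      fix m :: "('n, 'k) mpoly" assume "m \<in> mono_of ` level I (V - {x}) (Suc d)"
      then obtain t where m: "m = mono_of t" and t: "Poly_Mapping.keys t \<subseteq> V - {x}" "mdeg t = Suc d"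
        by (auto simp: level_def)
      then obtain i u where u: "t = Poly_Mapping.single i 1 + u" by (metis mdeg_pos_obtains zero_less_Suc)
      then have "u \<in> level (UNIV :: ('n, 'k) mpoly set) V d"
        using t by (auto simp: level_def mdeg_add mdeg_single keys_add_nat)
      then show "m \<in> ?A" unfolding m mono_of_mem_ideal_iff u by (metis add.commute)
    qed
  qed simp
  \<comment> \<open>No generator of \<open>?B\<close> involves \<open>x\<close>, so a generator
    dividing \<open>x\<close> times a monomial already divides that monomial.\<close>
  moreover have "f \<in> ?B" if "Var x * f \<in> ?B" for f
  proof (rule mem_monomial_ideal_iff[OF monomial_ideal_mono_of_image, THEN iffD2], rule ballI)
    fix t assume "t \<in> Poly_Mapping.keys f"
    then have "Poly_Mapping.single x 1 + t \<in> Poly_Mapping.keys (Var x * f)"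
      by (simp add: in_keys_iff Var_def lookup_mono_of_mult del: One_nat_def)
    with that have "(mono_of (Poly_Mapping.single x 1 + t) :: ('n, 'k) mpoly) \<in> ?B"
      using mem_monomial_ideal_iff[OF monomial_ideal_mono_of_image, THEN iffD1] by blast
    then obtain s u where s: "s \<in> level I (V - {x}) (Suc d)" and eq: "Poly_Mapping.single x 1 + t = s + u"
      unfolding mono_of_mem_ideal_iff by blast
    have "Poly_Mapping.lookup s x = 0" using s by (auto simp: level_def in_keys_iff)
    then have "0 < Poly_Mapping.lookup u x"
      using arg_cong[OF eq, of "\<lambda>p. Poly_Mapping.lookup p x"] by (simp add: lookup_add)
    then obtain u' where "u = Poly_Mapping.single x 1 + u'" by (rule lookup_pos_obtains)
    then have "Poly_Mapping.single x 1 + t = Poly_Mapping.single x 1 + (s + u')"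
      using eq by (simp only: add.left_commute)
    then have "t = s + u'" by (rule add_left_imp_eq)
    with s show "mono_of t \<in> ?B" unfolding mono_of_mem_ideal_iff by blast
  qed
  moreover have "homogeneous 1 (Var x :: ('n, 'k) mpoly)"
    by (simp add: homogeneous_def Var_def mdeg_single)
  ultimately show ?thesis
    using linear_ideal_mult_add[of "int d" ?A ?B "Var x"] assms(3,4) by (simp add: add.commute)
qed

text \<open>These ideals are the powers of the ideal generated by the variables in \<open>V\<close>.
  The outer induction on \<open>V\<close> covers all degrees, as the inner step uses a smaller
  degree in the same variables and the same degree in fewer variables.\<close>

lemma linear_level_UNIV: "linear_ideal (int d) (level_ideal (UNIV :: ('n::finite, 'k::field) mpoly set) V d)"
proof -
  have zero: "linear_ideal (int 0) (level_ideal (UNIV :: ('n, 'k) mpoly set) W 0)" for W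
  proof -
    have "level (UNIV :: ('n, 'k) mpoly set) W 0 = {0}" by (auto simp: level_def mdeg_eq_0_iff)
    then show ?thesis by (simp add: mono_of_0 ideal_of_1 linear_ideal_UNIV)
  qed
  have "finite V" by simp
  then show ?thesis
  proof (induction V arbitrary: d)
    case empty
    show ?case
    proof (cases d)
      case (Suc e)
      have "level (UNIV :: ('n, 'k) mpoly set) {} d = {}"
        using mdeg_eq_0_iff[of "0 :: 'n \<Rightarrow>\<^sub>0 nat"] by (auto simp: level_def Suc)
      then show ?thesis by (rule linear_level_empty)
    qed (simp only: zero)
  next
    case (insert x V)
    show ?case
    proof (induction d)
      case (Suc d)
      have "insert x V - {x} = V" using insert.hyps by simp
      then have "linear_ideal (int (Suc d)) (level_ideal (UNIV :: ('n, 'k) mpoly set) (insert x V - {x}) (Suc d))"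
        using insert.IH[of "Suc d"] by simp
      with Suc show ?case by (rule linear_level_step[OF insertI1 UNIV_I])
    qed (rule zero)
  qed
qed

section \<open>The operations that build critical ideals\<close>

lemma linear_level_mono_of_times:
  fixes J :: "('n::finite, 'k::field) mpoly set"
  assumes "\<And>V d. linear_ideal (int d) (level_ideal J V d)"
  shows "linear_ideal (int d) (level_ideal (mono_of s *o J) V d)"
proof -
  have mem: "mono_of t \<in> mono_of s *o J \<longleftrightarrow> (\<exists>u. t = s + u \<and> mono_of u \<in> J)" for t
  proof
    assume "mono_of t \<in> mono_of s *o J"
    then obtain f where f: "f \<in> J" "mono_of t = mono_of s * f" by (auto simp: elt_set_times_def)
    then obtain u where u: "t = s + u" by (metis dvd_triv_left mono_of_dvd_iff)
    then have "f = mono_of u" using f mono_of_mult_cancel[of s f "mono_of u"] by (simp add: mono_of_mult)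
    with u f show "\<exists>u. t = s + u \<and> mono_of u \<in> J" by blast
  next
    assume "\<exists>u. t = s + u \<and> mono_of u \<in> J"
    then show "mono_of t \<in> mono_of s *o J" by (auto simp: mono_of_mult[symmetric] intro: set_times_intro2)
  qed
  show ?thesis
  \<comment> \<open>If \<open>s\<close> fits into \<open>V\<close> and degree \<open>d\<close>, the
    level is a translate of a level of \<open>J\<close>, and \<open>d - mdeg s\<close> is a true
    difference. Otherwise no multiple of \<open>s\<close> qualifies and the level is empty.\<close>
  proof (cases "Poly_Mapping.keys s \<subseteq> V \<and> mdeg s \<le> d")
    case True
    then have "level (mono_of s *o J) V d = (+) s ` level J V (d - mdeg s)"
      by (auto simp: level_def mem keys_add_nat mdeg_add)
    then show ?thesis
      using linear_ideal_mono_of_times[OF assms[of "d - mdeg s" V], of s] True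
      by (simp add: ideal_of_mono_of_add_image of_nat_diff)
  next
    case False
    then have "level (mono_of s *o J) V d = {}" by (auto simp: level_def mem keys_add_nat mdeg_add)
    then show ?thesis by (rule linear_level_empty)
  qed
qed

lemma linear_level_add_Var:
  fixes J :: "('n::finite, 'k::field) mpoly set"
  assumes J: "monomial_ideal J" and lin: "\<And>V d. linear_ideal (int d) (level_ideal J V d)"
  shows "linear_ideal (int d) (level_ideal (ideal_of {Var x} + J) V d)"
proof -
  let ?I = "ideal_of {Var x} + J"
  have "0 \<in> J" using mem_monomial_ideal_iff[OF J, of 0] by simp
  have x: "mono_of (Poly_Mapping.single x 1 + u) \<in> ?I" for u
  proof -
    have "mono_of u * Var x + 0 \<in> ?I"
      using \<open>0 \<in> J\<close> by (intro set_plus_intro idl.span_scale idl.span_base) simp_all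
    then show ?thesis by (simp add: Var_def mono_of_mult add.commute)
  qed
  have without: "linear_ideal (int d) (level_ideal ?I V d)" if "x \<notin> V" for V d
  proof -
    \<comment> \<open>Terms of multiples of \<open>x\<close> involve \<open>x\<close>, so a monomial
      free of \<open>x\<close> must come from the summand in \<open>J\<close>.\<close>
    have "mono_of t \<in> ?I \<longleftrightarrow> mono_of t \<in> J" if t: "x \<notin> Poly_Mapping.keys t" for t
    proof
      assume "mono_of t \<in> ?I"
      then obtain f g where f: "f \<in> ideal_of {Var x}" and g: "g \<in> J" and eq: "mono_of t = f + g"
        unfolding set_plus_def by blast
      have "t \<notin> Poly_Mapping.keys f"
      proof
        assume "t \<in> Poly_Mapping.keys f"
        with f obtain u where "t = Poly_Mapping.single x 1 + u"
          using keys_ideal_of_monomials[of f "{Var x}" t] by (auto simp: monomial_def Var_def)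
        with t show False by (simp add: keys_add_nat)
      qed
      then have "t \<in> Poly_Mapping.keys g"
        using keys_add[of f g] by (metis UnE eq insertI1 keys_mono_of subsetD)
      with g show "mono_of t \<in> J" using mem_monomial_ideal_iff[OF J] by blast
    next
      assume "mono_of t \<in> J"
      then have "0 + mono_of t \<in> ?I" by (intro set_plus_intro idl.span_zero)
      then show "mono_of t \<in> ?I" by simp
    qed
    then have "level ?I V d = level J V d" using that by (auto simp: level_def)
    then show ?thesis using lin by simp
  qed
  show ?thesis
  proof (cases "x \<in> V")
    case True
    show ?thesis
    proof (cases d)
      case 0
      \<comment> \<open>The cone step reaches only positive degrees. In degree 0 the sole candidate
        exponent is 0, so removing \<open>x\<close> from \<open>V\<close> changes nothing.\<close>
      have "level ?I V 0 = level ?I (V - {x}) 0" by (auto simp: level_def mdeg_eq_0_iff)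
      then show ?thesis using without[of "V - {x}" 0] 0 by simp
    next
      case (Suc e)
      show ?thesis unfolding Suc by (rule linear_level_step[OF True x linear_level_UNIV without]) simp
    qed
  qed (rule without)
qed

lemma monomial_ideal_times:
  fixes J :: "('n, 'k::field) mpoly set"
  assumes "monomial_ideal J"
  shows "monomial_ideal (mono_of s *o J)"
proof -
  obtain A where A: "\<forall>m\<in>A. monomial m" "J = ideal_of A" using assms by (auto simp: monomial_ideal_def)
  then have "mono_of s *o J = ideal_of ((*) (mono_of s) ` A)" by (simp add: ideal_of_times_image)
  moreover have "\<forall>m\<in>(*) (mono_of s) ` A. monomial m"
    using A(1) by (auto simp: monomial_def mono_of_mult)
  ultimately show ?thesis unfolding monomial_ideal_def by blast
qed

lemma squarefree_monomial_ideal_imp_monomial_ideal: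
  "squarefree_monomial_ideal I \<Longrightarrow> monomial_ideal I"
  unfolding squarefree_monomial_ideal_def monomial_ideal_def
  using squarefree_monomial_imp_monomial by blast

text \<open>The base ideal \<open>(x, m)\<close> equals \<open>(x) + m S\<close>, so both rules are
  the same construction, started from the unit ideal.\<close>

lemma linear_level_critical:
  fixes I :: "('n::finite, 'k::field) mpoly set"
  assumes "critical I"
  shows "linear_ideal (int d) (level_ideal I V d)"
  using assms
proof (induction arbitrary: V d)
  case (base m i)
  obtain s where m: "m = mono_of s" using base(1) by (auto simp: squarefree_monomial_def)
  have "ideal_of {m} = m *o UNIV"
    using ideal_of_times_image[of m "{1}"] by (simp add: ideal_of_1)
  then have eq: "ideal_of {Var i, m} = ideal_of {Var i} + m *o UNIV"
    using ideal_of_Un[of "{Var i}" "{m}"] by (simp only: insert_is_Un[of "Var i" "{m}"])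
  have "monomial_ideal (UNIV :: ('n, 'k) mpoly set)"
    using monomial_ideal_mono_of_image[of "{0}"] by (simp add: mono_of_0 ideal_of_1)
  then show ?case
    unfolding eq unfolding m
    by (intro linear_level_add_Var monomial_ideal_times linear_level_mono_of_times linear_level_UNIV)
next
  case (step J m' j)
  obtain s where m': "m' = mono_of s" using step.hyps(2) by (auto simp: squarefree_monomial_def)
  have "monomial_ideal J"
    using critical_squarefree_monomial_ideal[OF step.hyps(1)]
    by (rule squarefree_monomial_ideal_imp_monomial_ideal)
  then show ?case
    unfolding m'
    by (intro linear_level_add_Var monomial_ideal_times linear_level_mono_of_times step.IH)
qed

theorem corollary3p5:
  fixes I :: "('n::finite, 'k::field) mpoly set"
  assumes "canonical_critical I"
  shows "componentwise_linear I"
proof -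
  obtain s J where I: "I = mono_of s *o J" and J: "critical J" and sq: "squarefree_monomial_ideal I"
    using assms by (auto simp: canonical_critical_def monomial_def)
  have mono: "monomial_ideal I" by (rule squarefree_monomial_ideal_imp_monomial_ideal[OF sq])
  then obtain A where A: "\<forall>m\<in>A. monomial m" "I = ideal_of A" by (auto simp: monomial_ideal_def)
  have "\<forall>m\<in>A. \<exists>d. homogeneous d m" using A(1) homogeneous_mono_of by (fastforce simp: monomial_def)
  then have "graded_ideal I" unfolding graded_ideal_def using A(2) by blast
  \<comment> \<open>The outer factor \<open>w\<close> is handled like the factor \<open>m'\<close>
    of a recursion step, now with \<open>V\<close> the set of all variables.\<close>
  moreover have "has_linear_resolution (degree_component_ideal I d)" for d
    unfolding degree_component_ideal_eq_level[OF mono]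
    unfolding I
    by (rule linear_ideal_imp_has_linear_resolution[OF
          linear_level_mono_of_times[OF linear_level_critical[OF J]]])
  ultimately show ?thesis unfolding componentwise_linear_def by blast
qed

end
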